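(* Let $q_1,q_2$ be coprime positive integers, $Q=q_1q_2$, and let $V:\mathbb{Z}^2\to\mathbb{R}$ be $(q_1,q_2)$-periodic. For $m\in\{1,\dots,Q\}$ and $k\in[0,1)^2$ let $\lambda_m(k)$ be the $m$-th smallest eigenvalue of $D_V(k)$. Let $\lambda_*$ be an extremum (the maximum or the minimum value) of $\lambda_m(k)$ over $k\in[0,1)^2$. Then the level set $\{k\in[0,1)^2:\lambda_m(k)=\lambda_*\}$ has cardinality at most $4q_1q_2$.
   Context: $V$ is $(q_1,q_2)$-periodic if $V(n_1,n_2)=V(n_1+q_1,n_2)=V(n_1,n_2+q_2)$ for all $(n_1,n_2)\in\mathbb{Z}^2$. The operator $\Delta+V$ acts on $u:\mathbb{Z}^2\to\mathbb{C}$ by $((\Delta+V)u)(n)=u(n_1+1,n_2)+u(n_1-1,n_2)+u(n_1,n_2+1)+u(n_1,n_2-1)+V(n)u(n)$. For $k=(k_1,k_2)\in\mathbb{R}^2$, $D_V(k)$ is the $Q\times Q$ matrix of $\Delta+V$ acting on the space of functions $u$ satisfying the Floquet–Bloch conditions $u(n_1+q_1,n_2)=e^{2\pi i k_1}u(n)$ and $u(n_1,n_2+q_2)=e^{2\pi ik_2}u(n)$ for all $n\in\mathbb{Z}^2$, written in the coordinates $\{u(n_1,n_2):1\le n_1\le q_1,\ 1\le n_2\le q_2\}$; it is Hermitian since $V$ is real, so its eigenvalues are real and $\lambda_1(k)\le\dots\le\lambda_Q(k)$. *)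

theory Defs
  imports "Jordan_Normal_Form.Char_Poly" "HOL-Computational_Algebra.Fundamental_Theorem_Algebra"
begin

definition periodic2 :: "nat \<Rightarrow> nat \<Rightarrow> (int \<times> int \<Rightarrow> real) \<Rightarrow> bool" where
  "periodic2 q1 q2 V \<longleftrightarrow>
     (\<forall>n1 n2. V (n1, n2) = V (n1 + int q1, n2) \<and> V (n1, n2) = V (n1, n2 + int q2))"

definition site :: "nat \<Rightarrow> nat \<Rightarrow> int \<times> int" where
  "site q1 i = (int (i mod q1) + 1, int (i div q1) + 1)"

definition nbr_offsets :: "(int \<times> int) list" where
  "nbr_offsets = [(1, 0), (-1, 0), (0, 1), (0, -1)]"

text \<open>Matrix D_V(k) of Delta + V on Floquet-Bloch functions: u(n+d) = u(m + (a q1, b q2))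
  = exp(2 pi i (a k1 + b k2)) u(m) when n + d - m = (a q1, b q2).\<close>
definition floquet_matrix ::
  "nat \<Rightarrow> nat \<Rightarrow> (int \<times> int \<Rightarrow> real) \<Rightarrow> real \<times> real \<Rightarrow> complex mat" where
  "floquet_matrix q1 q2 V k = mat (q1 * q2) (q1 * q2) (\<lambda>(i, j).
     (let n = site q1 i; m = site q1 j in
       (if i = j then complex_of_real (V n) else 0) +
       sum_list (map (\<lambda>d.
          let a1 = fst n + fst d - fst m; a2 = snd n + snd d - snd m in
          if a1 mod int q1 = 0 \<and> a2 mod int q2 = 0
          then exp (2 * complex_of_real pi * \<i> *
                    complex_of_real (fst k * of_int (a1 div int q1) + snd k * of_int (a2 div int q2)))
          else 0) nbr_offsets)))"

text \<open>lambda_m(k): the m-th smallest eigenvalue (m = 1..Q), counted with multiplicity,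
  as roots of the characteristic polynomial (real since the matrix is Hermitian).\<close>
definition band :: "nat \<Rightarrow> nat \<Rightarrow> (int \<times> int \<Rightarrow> real) \<Rightarrow> nat \<Rightarrow> real \<times> real \<Rightarrow> real" where
  "band q1 q2 V m k =
     sorted_list_of_multiset (image_mset Re (proots (char_poly (floquet_matrix q1 q2 V k)))) ! (m - 1)"

definition unit_cell :: "(real \<times> real) set" where
  "unit_cell = {k. 0 \<le> fst k \<and> fst k < 1 \<and> 0 \<le> snd k \<and> snd k < 1}"

end

theory Submission
  imports
    "Jordan_Normal_Form.Schur_Decomposition"
    "HOL-Computational_Algebra.Field_as_Ring"
    Defs
begin

text \<open>In terms of the Floquet multipliers \<open>x = exp (2 \<pi> \<i> k\<^sub>1)\<close> and \<open>z = exp (2 \<pi> \<i> k\<^sub>2)\<close> the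
  determinant of \<open>\<lambda> - D\<^sub>V(k)\<close> is a Laurent polynomial \<open>P\<close> whose Newton polygon is the diamond with
  vertices \<open>(\<plusminus>q2, 0)\<close>, \<open>(0, \<plusminus>q1)\<close>. At an extremum \<open>\<lambda>\<close> of a band both \<open>P\<close> and \<open>x \<partial>P/\<partial>x\<close>
  vanish: at a simple eigenvalue because \<open>P\<close> does not change sign, at a multiple one because a
  Hermitian matrix is diagonalizable. Twice the area of the diamond being \<open>4 * q1 * q2\<close>, this
  bounds the number of common zeros: the resultant of the two functions with respect to \<open>x\<close> has
  its exponents in an interval of length \<open>4 * q1 * q2\<close>, vanishes at \<open>c\<close> at least to the order of
  the number of common zeros over \<open>c\<close>, and is not identically zero because, \<open>q1\<close> and \<open>q2\<close> being
  coprime, the edges of the diamond contain no lattice points besides the vertices.\<close>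

section \<open>Common zeros of a Laurent polynomial and its derivative\<close>

text \<open>Two equations in two unknowns are wanted, so only \<open>k1\<close> is varied, and x
  d/dx is preferred to d/dx because it keeps the support inside the diamond. The count is of
  Bernstein-Kushnirenko type, proved by eliminating x. The obstacle is a common factor of P and x
  dP/dx, such as a repeated factor of P, which would make the zero set infinite. It is excluded on a
  single fibre z = \<open>T ^ q2\<close> with T large. For |x| >= 1 only the vertices (q2, 0) and
  (0, q1) matter there: P is close to a binomial in x, while x dP/dx is close to q2 times the x-term
  of that binomial alone, and both cannot vanish together. The substitution x -> 1/x covers |x| < 1.
  As for the constant: after clearing denominators the resultant is a polynomial in z with exponents
  between \<open>2 * q1 * q2\<close> and \<open>6 * q1 * q2\<close>, and only its nonzero roots
  matter.\<close>

definition laurent2 ::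
  "nat \<Rightarrow> nat \<Rightarrow> (int \<Rightarrow> int \<Rightarrow> complex) \<Rightarrow> complex \<Rightarrow> complex \<Rightarrow> complex" where
  "laurent2 q1 q2 p x z =
     (\<Sum>(a, b)\<in>{- int q2..int q2} \<times> {- int q1..int q1}. p a b * x powi a * z powi b)"

text \<open>The right, left and top vertices are those that dominate when z is large. The left and
  right ones are also the extreme coefficients in x, which keeps the degree of the fibre polynomials
  constant.\<close>

locale newton_diamond =
  fixes q1 q2 :: nat and p :: "int \<Rightarrow> int \<Rightarrow> complex"
  assumes q1_pos: "q1 > 0" and q2_pos: "q2 > 0" and cop: "coprime q1 q2"
    and supp: "\<And>a b. p a b \<noteq> 0 \<Longrightarrow> int q1 * \<bar>a\<bar> + int q2 * \<bar>b\<bar> \<le> int (q1 * q2)"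
    and vertex_right: "p (int q2) 0 \<noteq> 0" and vertex_left: "p (- int q2) 0 \<noteq> 0"
    and vertex_top: "p 0 (int q1) \<noteq> 0"

section \<open>Dominance of two vertices on fibres with large z\<close>

lemma diamond_edge:
  fixes q1 q2 :: nat and a b :: int
  assumes "q1 > 0" "q2 > 0" "coprime q1 q2"
    and le: "int q1 * \<bar>a\<bar> + int q2 * \<bar>b\<bar> \<le> int (q1 * q2)"
    and ne: "(a, b) \<noteq> (int q2, 0)" "(a, b) \<noteq> (0, int q1)"
  shows "int q1 * a + int q2 * b \<le> int (q1 * q2) - 1"
proof (rule ccontr)
  assume "\<not> ?thesis"
  then have ge: "int q1 * a + int q2 * b \<ge> int (q1 * q2)" by simp
  have m: "int q1 * a \<le> int q1 * \<bar>a\<bar>" "int q2 * b \<le> int q2 * \<bar>b\<bar>"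
    by (simp_all add: mult_left_mono)
  have "int q1 * a = int q1 * \<bar>a\<bar>" "int q2 * b = int q2 * \<bar>b\<bar>" and
    eq: "int q1 * a + int q2 * b = int q1 * int q2"
    using m le ge unfolding of_nat_mult by linarith+
  then have "a = \<bar>a\<bar>" "b = \<bar>b\<bar>" using assms(1,2) by simp_all
  then have nn: "a \<ge> 0" "b \<ge> 0" by linarith+
  \<comment> \<open>Here coprimality acts: \<open>q2\<close> divides \<open>q1 * a\<close>, hence
    \<open>a\<close>, so \<open>a = q2 * t\<close> where t can only be 0 or 1, and these are the two
    vertices. By integrality every other point stays at least 1 below the edge.\<close>
  have "int q2 dvd int q1 * a"
    by (subst dvd_add_left_iff[of _ "int q2 * b", symmetric]) (simp_all add: eq)
  moreover have "coprime (int q2) (int q1)" using assms(3) by (simp add: coprime_commute)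
  ultimately have "int q2 dvd a" using coprime_dvd_mult_right_iff by blast
  then obtain t where t: "a = int q2 * t" by blast
  have "int q1 * (int q2 * t) \<le> int q1 * int q2"
    using eq nn unfolding t[symmetric] by (smt (verit) mult_nonneg_nonneg of_nat_0_le_iff)
  then have "t \<le> 1" using assms(1,2) by (simp add: mult_le_cancel_left)
  moreover have "t \<ge> 0" using nn t assms(2) by (simp add: zero_le_mult_iff)
  ultimately consider "t = 0" | "t = 1" by linarith
  then show False
  proof cases
    case 1
    then have "a = 0" using t by simp
    then have "b = int q1" using eq assms(2) by (simp add: mult.commute)
    then show False using ne \<open>a = 0\<close> by simp
  next
    case 2
    then have "a = int q2" using t by simp
    then have "b = 0" using eq assms(2) by (simp add: mult.commute)
    then show False using ne \<open>a = int q2\<close> by simp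
  qed
qed

text \<open>Here r is |x| and |z| is \<open>T ^ q2\<close>. The gap of 1 in
  \<open>diamond_edge\<close> becomes the factor 1/T. For a > 0 the radius r is compared with
  \<open>T ^ q1\<close>, where the two vertex monomials balance: below it r is replaced by
  \<open>T ^ q1\<close>, above it powers of T are traded for powers of r. For a <= 0 the power of r
  is at most 1.\<close>

lemma diamond_monomial_bound:
  fixes q1 q2 :: nat and a b :: int and T r :: real
  assumes q: "q1 > 0" "q2 > 0" "coprime q1 q2"
    and le: "int q1 * \<bar>a\<bar> + int q2 * \<bar>b\<bar> \<le> int (q1 * q2)"
    and ne: "(a, b) \<noteq> (int q2, 0)" "(a, b) \<noteq> (0, int q1)"
    and T: "T \<ge> 1" and r: "r \<ge> 1"
  shows "r powi a * T powi (int q2 * b) \<le> max (T ^ (q1 * q2)) (r ^ q2) / T"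
proof -
  have edge: "int q1 * a + int q2 * b \<le> int (q1 * q2) - 1"
    using diamond_edge[OF q le ne] .
  have lt: "int q1 * \<bar>a\<bar> \<le> int q1 * int q2" using le
    by (smt (verit) mult_nonneg_nonneg of_nat_0_le_iff of_nat_mult)
  have a_le: "\<bar>a\<bar> \<le> int q2" using lt q(1) by (simp add: mult_le_cancel_left)
  have TQ: "T powi (int (q1 * q2) - 1) = T ^ (q1 * q2) / T"
    using T by (simp add: power_int_diff del: of_nat_mult)
  have mx: "T ^ (q1 * q2) / T \<le> max (T ^ (q1 * q2)) (r ^ q2) / T"
    "r ^ q2 / T \<le> max (T ^ (q1 * q2)) (r ^ q2) / T"
    using T by (auto intro!: divide_right_mono)
  show ?thesis
  proof (cases "a \<le> 0")
    case True
    have "r powi a \<le> 1"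
      using power_int_increasing[of a 0 r] True r by simp
    moreover have "int q2 * b \<le> int (q1 * q2) - 1"
    proof (cases "a = 0")
      case True
      then show ?thesis using edge by simp
    next
      case False
      then have "0 < int q1 * \<bar>a\<bar>" using q(1) by simp
      moreover have "int q2 * b \<le> int q2 * \<bar>b\<bar>" by (simp add: mult_left_mono)
      ultimately show ?thesis using le by linarith
    qed
    then have "T powi (int q2 * b) \<le> T powi (int (q1 * q2) - 1)"
      using T by (intro power_int_increasing) auto
    moreover have "0 \<le> r powi a" "0 \<le> T powi (int q2 * b)" using r T by auto
    ultimately have "r powi a * T powi (int q2 * b) \<le> 1 * T powi (int (q1 * q2) - 1)"
      by (intro mult_mono) auto
    then show ?thesis using TQ mx by linarith
  next
    case False
    show ?thesis
    proof (cases "r \<le> T ^ q1")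
      case True
      have "r powi a \<le> (T ^ q1) powi a"
        using True r False by (intro power_int_mono) auto
      also have "\<dots> = T powi (int q1 * a)" by (simp add: power_int_mult)
      finally have "r powi a * T powi (int q2 * b) \<le> T powi (int q1 * a) * T powi (int q2 * b)"
        using T by (intro mult_right_mono) auto
      also have "\<dots> = T powi (int q1 * a + int q2 * b)" using T by (simp add: power_int_add)
      also have "\<dots> \<le> T powi (int (q1 * q2) - 1)"
        using T edge by (intro power_int_increasing) auto
      finally show ?thesis using TQ mx by linarith
    next
      case rT: False
      \<comment> \<open>The additional factor T is what the gap of 1 below the edge pays
        for.\<close>
      have "T powi (int q2 * b + 1) \<le> T powi (int q1 * (int q2 - a))"
        using T edge by (intro power_int_increasing) (auto simp: algebra_simps)
      also have "\<dots> = (T ^ q1) powi (int q2 - a)" by (simp add: power_int_mult)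
      also have "\<dots> \<le> r powi (int q2 - a)"
        using rT T a_le by (intro power_int_mono) auto
      finally have "r powi a * T powi (int q2 * b + 1) \<le> r powi a * r powi (int q2 - a)"
        using r by (intro mult_left_mono) auto
      also have "\<dots> = r ^ q2" using r by (simp flip: power_int_add)
      finally have "r powi a * T powi (int q2 * b) * T \<le> r ^ q2"
        using T by (simp add: power_int_add)
      then have "r powi a * T powi (int q2 * b) \<le> r ^ q2 / T"
        using T by (simp add: pos_le_divide_eq)
      then show ?thesis using mx by linarith
    qed
  qed
qed

context newton_diamond
begin

text \<open>Only two lattice points of the support lie on the upper right edge of the diamond (this is
  where coprimality enters), so for large \<open>T\<close> they dominate all other monomials.\<close>

lemma laurent2_split_bound:
  fixes g :: "int \<Rightarrow> int \<Rightarrow> complex" and T :: real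
  assumes gs: "\<And>a b. g a b \<noteq> 0 \<Longrightarrow> int q1 * \<bar>a\<bar> + int q2 * \<bar>b\<bar> \<le> int (q1 * q2)"
    and T: "T \<ge> 1" and x: "norm x \<ge> 1"
  shows "norm (laurent2 q1 q2 g x (of_real T ^ q2) -
            g (int q2) 0 * x ^ q2 - g 0 (int q1) * of_real T ^ (q1 * q2))
     \<le> (\<Sum>(a, b)\<in>{- int q2..int q2} \<times> {- int q1..int q1}. norm (g a b)) *
        (max (T ^ (q1 * q2)) (norm x ^ q2) / T)"
proof -
  define B where "B = {- int q2..int q2} \<times> {- int q1..int q1}"
  define B' where "B' = B - {(int q2, 0), (0, int q1)}"
  define M where "M = max (T ^ (q1 * q2)) (norm x ^ q2) / T"
  define f where "f = (\<lambda>(a, b). g a b * x powi a * (of_real T ^ q2) powi b)"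
  have fin: "finite B" by (simp add: B_def)
  have M0: "M \<ge> 0" unfolding M_def using T
    by (intro divide_nonneg_nonneg) (auto simp: le_max_iff_disj)
  have "laurent2 q1 q2 g x (of_real T ^ q2) = sum f B"
    by (simp add: laurent2_def f_def B_def)
  also have "sum f B = sum f {(int q2, 0), (0, int q1)} + sum f B'"
    unfolding B'_def by (subst sum.subset_diff[of "{(int q2, 0), (0, int q1)}"])
      (use fin in \<open>auto simp: B_def\<close>)
  also have "sum f {(int q2, 0), (0, int q1)} =
      g (int q2) 0 * x ^ q2 + g 0 (int q1) * of_real T ^ (q1 * q2)"
    using q1_pos q2_pos by (simp add: f_def power_mult mult.commute[of q1])
  finally have eq: "laurent2 q1 q2 g x (of_real T ^ q2) -
      g (int q2) 0 * x ^ q2 - g 0 (int q1) * of_real T ^ (q1 * q2) = sum f B'" by simp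
  have bnd: "norm (f y) \<le> norm (g (fst y) (snd y)) * M" if y: "y \<in> B'" for y
  proof (cases "g (fst y) (snd y) = 0")
    case True
    then show ?thesis by (simp add: f_def case_prod_beta)
  next
    case False
    obtain a b where ab: "y = (a, b)" by force
    have "norm x powi a * T powi (int q2 * b) \<le> M" unfolding M_def
      using y ab False gs[of a b]
      by (intro diamond_monomial_bound q1_pos q2_pos cop T x) (auto simp: B'_def)
    moreover have "norm (f y) = norm (g a b) * (norm x powi a * T powi (int q2 * b))"
      using T by (simp add: f_def ab norm_mult norm_power_int power_int_mult norm_power)
    ultimately show ?thesis using ab by (simp add: mult_left_mono)
  qed
  have "norm (sum f B') \<le> (\<Sum>y\<in>B'. norm (g (fst y) (snd y)) * M)"
    using bnd by (rule sum_norm_le)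
  also have "\<dots> \<le> (\<Sum>y\<in>B. norm (g (fst y) (snd y)) * M)"
    using fin M0 by (intro sum_mono2) (auto simp: B'_def)
  also have "\<dots> = (\<Sum>(a, b)\<in>B. norm (g a b)) * M"
    by (simp add: sum_distrib_right case_prod_beta)
  finally show ?thesis by (simp add: eq B_def M_def)
qed

text \<open>The factor a annihilates the vertex (0, q1), so a vanishing derivative makes the
  \<open>x ^ q2\<close> term small, and then P = 0 makes the \<open>T ^ (q1 * q2)\<close> term small
  as well. Small means at most \<open>K * (M / T)\<close>, where M is the larger of the two powers
  in modulus; this fails once T exceeds both K / A and K / B.\<close>

lemma no_common_zero_outside_disc:
  "\<exists>T0\<ge>1. \<forall>T\<ge>T0. \<forall>x. norm x \<ge> 1 \<longrightarrow>
     laurent2 q1 q2 p x (of_real T ^ q2) = 0 \<longrightarrow>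
     laurent2 q1 q2 (\<lambda>a b. of_int a * p a b) x (of_real T ^ q2) \<noteq> 0"
proof -
  define S where "S g = (\<Sum>(a, b)\<in>{- int q2..int q2} \<times> {- int q1..int q1}. norm (g a b))"
    for g :: "int \<Rightarrow> int \<Rightarrow> complex"
  define p' where "p' = (\<lambda>a b. of_int a * p a b)"
  define A where "A = norm (p (int q2) 0)"
  define B where "B = norm (p 0 (int q1))"
  define K where "K = S p + S p'"
  have A: "A > 0" and B: "B > 0" using vertex_right vertex_top by (auto simp: A_def B_def)
  have S0: "S g \<ge> 0" for g by (auto simp: S_def intro!: sum_nonneg)
  define T0 where "T0 = 1 + K / A + K / B"
  have "T0 \<ge> 1" using A B S0 by (auto simp: T0_def K_def)
  moreover have False
    if T: "T \<ge> T0" and x: "norm x \<ge> 1"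
      and P: "laurent2 q1 q2 p x (of_real T ^ q2) = 0"
      and P': "laurent2 q1 q2 p' x (of_real T ^ q2) = 0" for T x
  proof -
    have T1: "T \<ge> 1" using T \<open>T0 \<ge> 1\<close> by simp
    define M where "M = max (T ^ (q1 * q2)) (norm x ^ q2)"
    have M: "M > 0" using T1 by (auto simp: M_def less_max_iff_disj)
    have 1: "norm (p (int q2) 0 * x ^ q2 + p 0 (int q1) * of_real T ^ (q1 * q2)) \<le> S p * (M / T)"
      using laurent2_split_bound[of p T x] supp T1 x P norm_minus_cancel[of "p (int q2) 0 * x ^ q2 + p 0 (int q1) * of_real T ^ (q1 * q2)"]
      by (simp add: S_def M_def)
    have "norm (of_nat q2 * p (int q2) 0 * x ^ q2) \<le> S p' * (M / T)"
      using laurent2_split_bound[of p' T x] supp T1 x P'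
      by (simp add: S_def M_def p'_def)
    moreover have "A * norm x ^ q2 \<le> norm (of_nat q2 * p (int q2) 0 * x ^ q2)"
    proof -
      have "1 * (A * norm x ^ q2) \<le> real q2 * (A * norm x ^ q2)"
        using q2_pos A by (intro mult_right_mono) auto
      then show ?thesis by (simp add: norm_mult norm_power A_def mult_ac)
    qed
    ultimately have 2: "A * norm x ^ q2 \<le> S p' * (M / T)" by linarith
    have "B * T ^ (q1 * q2) = norm (p 0 (int q1) * of_real T ^ (q1 * q2))"
      using T1 by (simp add: B_def norm_mult norm_power)
    also have "\<dots> \<le> norm (p (int q2) 0 * x ^ q2 + p 0 (int q1) * of_real T ^ (q1 * q2)) +
        norm (p (int q2) 0 * x ^ q2)"
      by (metis add.commute add_diff_cancel_left' norm_triangle_sub norm_minus_commute norm_triangle_ineq4)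
    also have "norm (p (int q2) 0 * x ^ q2) = A * norm x ^ q2"
      by (simp add: A_def norm_mult norm_power)
    finally have 3: "B * T ^ (q1 * q2) \<le> K * (M / T)" using 1 2
      by (simp add: K_def algebra_simps)
    have "A * norm x ^ q2 \<le> K * (M / T)"
    proof -
      have "S p' * (M / T) \<le> K * (M / T)" using M T1 S0 by (intro mult_right_mono) (auto simp: K_def)
      then show ?thesis using 2 by linarith
    qed
    with 3 have "min A B * M \<le> K * (M / T)"
    proof -
      have "min A B * M \<le> max (A * norm x ^ q2) (B * T ^ (q1 * q2))"
      proof (cases "T ^ (q1 * q2) \<le> norm x ^ q2")
        case True
        then have "min A B * M \<le> A * norm x ^ q2"
          unfolding M_def by (simp add: max_absorb2 mult_right_mono)
        then show ?thesis by linarith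
      next
        case False
        then have "min A B * M \<le> B * T ^ (q1 * q2)"
          unfolding M_def using T1 by (simp add: max_absorb1 mult_right_mono)
        then show ?thesis by linarith
      qed
      then show ?thesis using 3 \<open>A * norm x ^ q2 \<le> K * (M / T)\<close> by linarith
    qed
    then have "min A B \<le> K / T" using M T1 by (simp add: field_simps)
    then have "min A B * T \<le> K" using T1 by (simp add: field_simps)
    moreover have "A * T > K"
    proof -
      have "T > K / A" using T B S0[of p] S0[of p'] unfolding T0_def
        by (smt (verit, best) K_def divide_nonneg_pos)
      then show ?thesis using A by (simp add: field_simps)
    qed
    moreover have "B * T > K"
    proof -
      have "T > K / B" using T A S0[of p] S0[of p'] unfolding T0_def
        by (smt (verit, best) K_def divide_nonneg_pos)
      then show ?thesis using B by (simp add: field_simps)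
    qed
    ultimately show False by (auto simp: min_def split: if_splits)
  qed
  ultimately show ?thesis unfolding p'_def by blast
qed

end

lemma laurent2_reflect: "laurent2 q1 q2 (\<lambda>a b. p (- a) b) x z = laurent2 q1 q2 p (inverse x) z"
  unfolding laurent2_def
  by (rule sum.reindex_bij_witness[of _ "\<lambda>(a, b). (- a, b)" "\<lambda>(a, b). (- a, b)"])
    (auto simp: power_int_minus power_int_inverse)

text \<open>Points with |x| < 1 are reduced to the previous case by x -> 1/x, which preserves the
  diamond, exchanges its left and right vertices and changes the sign of x d/dx.\<close>

lemma (in newton_diamond) exists_fibre_without_common_zero:
  "\<exists>c. c \<noteq> 0 \<and> (\<forall>x. x \<noteq> 0 \<longrightarrow> laurent2 q1 q2 p x c = 0 \<longrightarrow>
     laurent2 q1 q2 (\<lambda>a b. of_int a * p a b) x c \<noteq> 0)"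
proof -
  interpret R: newton_diamond q1 q2 "\<lambda>a b. p (- a) b"
  proof
    show "int q1 * \<bar>a\<bar> + int q2 * \<bar>b\<bar> \<le> int (q1 * q2)" if "p (- a) b \<noteq> 0" for a b
      using supp[OF that] by simp
  qed (use q1_pos q2_pos cop vertex_left vertex_right vertex_top in simp_all)
  obtain T1 where T1: "\<And>T x. T \<ge> T1 \<Longrightarrow> norm x \<ge> 1 \<Longrightarrow>
     laurent2 q1 q2 p x (of_real T ^ q2) = 0 \<Longrightarrow>
     laurent2 q1 q2 (\<lambda>a b. of_int a * p a b) x (of_real T ^ q2) \<noteq> 0" and "T1 \<ge> 1"
    using no_common_zero_outside_disc by blast
  obtain T2 where T2: "\<And>T x. T \<ge> T2 \<Longrightarrow> norm x \<ge> 1 \<Longrightarrow>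
     laurent2 q1 q2 (\<lambda>a b. p (- a) b) x (of_real T ^ q2) = 0 \<Longrightarrow>
     laurent2 q1 q2 (\<lambda>a b. of_int a * p (- a) b) x (of_real T ^ q2) \<noteq> 0"
    using R.no_common_zero_outside_disc by blast
  define T where "T = max T1 T2"
  have minus: "laurent2 q1 q2 (\<lambda>a b. of_int a * p (- a) b) x z =
      - laurent2 q1 q2 (\<lambda>a b. of_int a * p a b) (inverse x) z" for x z
  proof -
    have "laurent2 q1 q2 (\<lambda>a b. of_int a * p (- a) b) x z =
        - laurent2 q1 q2 (\<lambda>a b. of_int (- a) * p (- a) b) x z"
      by (simp add: laurent2_def case_prod_beta sum_negf)
    also have "laurent2 q1 q2 (\<lambda>a b. of_int (- a) * p (- a) b) x z =
        laurent2 q1 q2 (\<lambda>a b. of_int a * p a b) (inverse x) z"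
      by (rule laurent2_reflect)
    finally show ?thesis .
  qed
  have "laurent2 q1 q2 (\<lambda>a b. of_int a * p a b) x (of_real T ^ q2) \<noteq> 0"
    if "x \<noteq> 0" "laurent2 q1 q2 p x (of_real T ^ q2) = 0" for x
  proof (cases "norm x \<ge> 1")
    case True
    then show ?thesis using T1[of T x] that by (simp add: T_def)
  next
    case False
    then have "norm (inverse x) \<ge> 1" using that
      unfolding norm_inverse one_le_inverse_iff by simp
    then show ?thesis using T2[of T "inverse x"] that
      by (simp add: T_def laurent2_reflect minus)
  qed
  moreover have "of_real T ^ q2 \<noteq> (0 :: complex)" using \<open>T1 \<ge> 1\<close> by (simp add: T_def)
  ultimately show ?thesis by blast
qed

section \<open>Fibre polynomials and their Sylvester matrix\<close>

definition coeff_poly :: "nat \<Rightarrow> nat \<Rightarrow> (int \<Rightarrow> int \<Rightarrow> complex) \<Rightarrow> nat \<Rightarrow> complex poly" where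
  "coeff_poly q1 q2 g i = (\<Sum>b\<in>{- int q1..int q1}. monom (g (int i - int q2) b) (nat (b + int q1)))"

text \<open>For c other than 0 this is the restriction to the fibre z = c, multiplied by
  \<open>x ^ q2 * c ^ q1\<close> to clear negative exponents. Its coefficients depend polynomially
  on c, through \<open>coeff_poly\<close>, whose index i stands for the exponent i - q2 of
  x.\<close>

definition fibre_poly :: "nat \<Rightarrow> nat \<Rightarrow> (int \<Rightarrow> int \<Rightarrow> complex) \<Rightarrow> complex \<Rightarrow> complex poly" where
  "fibre_poly q1 q2 g c = (\<Sum>i\<le>2 * q2. monom (poly (coeff_poly q1 q2 g i) c) i)"

lemma coeff_coeff_poly:
  "coeff (coeff_poly q1 q2 g i) n =
     (if n \<le> 2 * q1 then g (int i - int q2) (int n - int q1) else 0)"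
proof -
  have "coeff (coeff_poly q1 q2 g i) n =
      (\<Sum>b\<in>{- int q1..int q1}. if b = int n - int q1 then g (int i - int q2) b else 0)"
    unfolding coeff_poly_def coeff_sum by (intro sum.cong) auto
  also have "\<dots> = (if n \<le> 2 * q1 then g (int i - int q2) (int n - int q1) else 0)"
    by (subst sum.delta) auto
  finally show ?thesis .
qed

lemma poly_coeff_poly:
  assumes "c \<noteq> 0"
  shows "poly (coeff_poly q1 q2 g i) c =
    c ^ q1 * (\<Sum>b\<in>{- int q1..int q1}. g (int i - int q2) b * c powi b)"
proof -
  have "c ^ nat (b + int q1) = c ^ q1 * c powi b" if "- int q1 \<le> b" for b
  proof -
    have "c ^ nat (b + int q1) = c powi (b + int q1)"
      using that by (simp add: power_int_def)
    then show ?thesis using assms by (simp add: power_int_add mult.commute)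
  qed
  then show ?thesis unfolding coeff_poly_def poly_sum poly_monom sum_distrib_left
    by (intro sum.cong) (simp_all add: mult_ac)
qed

lemma coeff_fibre_poly:
  "coeff (fibre_poly q1 q2 g c) i = (if i \<le> 2 * q2 then poly (coeff_poly q1 q2 g i) c else 0)"
  unfolding fibre_poly_def coeff_sum by (auto simp: sum.delta)

lemma poly_fibre_poly:
  assumes "c \<noteq> 0" "x \<noteq> 0"
  shows "poly (fibre_poly q1 q2 g c) x = x ^ q2 * c ^ q1 * laurent2 q1 q2 g x c"
proof -
  have "poly (fibre_poly q1 q2 g c) x =
      (\<Sum>i\<le>2 * q2. \<Sum>b\<in>{- int q1..int q1}. c ^ q1 * (g (int i - int q2) b * c powi b) * x ^ i)"
    unfolding fibre_poly_def poly_sum poly_monom poly_coeff_poly[OF assms(1)]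
    by (simp add: sum_distrib_left sum_distrib_right)
  also have "\<dots> = (\<Sum>a\<in>{- int q2..int q2}. \<Sum>b\<in>{- int q1..int q1}.
      x ^ q2 * c ^ q1 * (g a b * x powi a * c powi b))"
  proof (rule sum.reindex_bij_witness[of _ "\<lambda>a. nat (a + int q2)" "\<lambda>i. int i - int q2"])
    fix i assume "i \<in> {..2 * q2}"
    have "x ^ q2 * x powi (int i - int q2) = x ^ i"
      using assms by (simp add: power_int_diff)
    then have "x ^ q2 * (x powi (int i - int q2) * u) = x ^ i * u" for u
      by (metis mult.assoc)
    then show "(\<Sum>b\<in>{- int q1..int q1}.
        x ^ q2 * c ^ q1 * (g (int i - int q2) b * x powi (int i - int q2) * c powi b)) =
      (\<Sum>b\<in>{- int q1..int q1}. c ^ q1 * (g (int i - int q2) b * c powi b) * x ^ i)"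
      by (intro sum.cong) (simp_all add: mult_ac)
  qed auto
  also have "\<dots> = x ^ q2 * c ^ q1 * laurent2 q1 q2 g x c"
    unfolding laurent2_def sum.cartesian_product[symmetric] by (simp add: sum_distrib_left)
  finally show ?thesis .
qed

text \<open>The columns of this Sylvester matrix hold the coefficients of the products of
  \<open>x ^ s\<close>, \<open>s < 2 * q2\<close>, with the fibre polynomials of \<open>g\<close> and of \<open>h\<close>.\<close>

definition sylvester_entry ::
  "nat \<Rightarrow> nat \<Rightarrow> (int \<Rightarrow> int \<Rightarrow> complex) \<Rightarrow> nat \<Rightarrow> nat \<Rightarrow> complex poly" where
  "sylvester_entry q1 q2 g s j =
     (if s \<le> j \<and> j \<le> s + 2 * q2 then coeff_poly q1 q2 g (j - s) else 0)"

definition sylvester ::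
  "nat \<Rightarrow> nat \<Rightarrow> (int \<Rightarrow> int \<Rightarrow> complex) \<Rightarrow> (int \<Rightarrow> int \<Rightarrow> complex) \<Rightarrow> complex poly mat" where
  "sylvester q1 q2 g h = mat (4 * q2) (4 * q2) (\<lambda>(j, r).
     if r < 2 * q2 then sylvester_entry q1 q2 g r j else sylvester_entry q1 q2 h (r - 2 * q2) j)"

lemma poly_sylvester_entry:
  "poly (sylvester_entry q1 q2 g s j) c =
     (if s \<le> j then coeff (fibre_poly q1 q2 g c) (j - s) else 0)"
proof -
  have "j \<le> s + 2 * q2 \<longleftrightarrow> j - s \<le> 2 * q2" if "s \<le> j" using that by linarith
  then show ?thesis unfolding sylvester_entry_def coeff_fibre_poly by simp
qed

text \<open>Multiplying a column by the row of powers of x evaluates the corresponding product at x.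
  A common zero of both fibre polynomials therefore gives a row vector that annihilates the whole
  matrix evaluated at c.\<close>

lemma sum_poly_sylvester_entry:
  assumes "s < 2 * q2"
  shows "(\<Sum>j<4 * q2. x ^ j * poly (sylvester_entry q1 q2 g s j) c) =
    x ^ s * poly (fibre_poly q1 q2 g c) x"
proof -
  have "(\<Sum>j<4 * q2. x ^ j * poly (sylvester_entry q1 q2 g s j) c) =
      (\<Sum>j\<in>{s..s + 2 * q2}. x ^ j * poly (coeff_poly q1 q2 g (j - s)) c)"
    using assms by (intro sum.mono_neutral_cong_right) (auto simp: sylvester_entry_def)
  also have "\<dots> = (\<Sum>i\<le>2 * q2. x ^ (i + s) * poly (coeff_poly q1 q2 g i) c)"
    by (rule sum.reindex_bij_witness[of _ "\<lambda>i. i + s" "\<lambda>j. j - s"]) auto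
  also have "\<dots> = x ^ s * poly (fibre_poly q1 q2 g c) x"
    unfolding fibre_poly_def poly_sum poly_monom sum_distrib_left
    by (intro sum.cong) (simp_all add: power_add mult_ac)
  finally show ?thesis .
qed

subsection \<open>Nonvanishing of the resultant\<close>

lemma coprime_poly_complex:
  fixes F G :: "complex poly"
  assumes "F \<noteq> 0" and nz: "\<And>x. poly F x = 0 \<Longrightarrow> poly G x \<noteq> 0"
  shows "coprime F G"
proof (rule coprimeI)
  fix d assume d: "d dvd F" "d dvd G"
  show "is_unit d"
  proof (rule ccontr)
    assume nu: "\<not> is_unit d"
    have "d \<noteq> 0" using d assms(1) by auto
    with nu have "degree d \<noteq> 0" by (simp add: is_unit_iff_degree)
    then have "\<not> constant (poly d)" by (simp add: constant_degree)
    then obtain x where "poly d x = 0" using fundamental_theorem_of_algebra by blast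
    then have "poly F x = 0" "poly G x = 0" using d by (auto elim: dvdE)
    then show False using nz by blast
  qed
qed

text \<open>A kernel vector of the matrix evaluated at c is a pair a, b of polynomials of degree
  below \<open>2 * q2\<close> with a * F + b * G = 0. Coprimality gives F dvd b, and the exact
  degree of F forces b = 0. One good fibre thus shows that the determinant is not the zero
  polynomial.\<close>

lemma det_sylvester_nonzero:
  assumes n: "q2 > 0" and deg: "degree (fibre_poly q1 q2 g c) = 2 * q2"
    and nz: "\<And>x. poly (fibre_poly q1 q2 g c) x = 0 \<Longrightarrow> poly (fibre_poly q1 q2 h c) x \<noteq> 0"
  shows "det (sylvester q1 q2 g h) \<noteq> 0"
proof
  define F where "F = fibre_poly q1 q2 g c"
  define G where "G = fibre_poly q1 q2 h c"
  define N where "N = 2 * q2"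
  define A where "A = map_mat (\<lambda>f. poly f c) (sylvester q1 q2 g h)"
  have Ac: "A \<in> carrier_mat (4 * q2) (4 * q2)" by (simp add: A_def sylvester_def)
  assume 0: "det (sylvester q1 q2 g h) = 0"
  have "poly (det (sylvester q1 q2 g h)) c = det A"
    by (rule poly_det_cong[OF Ac]) (auto simp: A_def sylvester_def)
  with 0 have "det A = 0" by simp
  then obtain v where v: "v \<in> carrier_vec (4 * q2)" "v \<noteq> 0\<^sub>v (4 * q2)"
    and Av: "A *\<^sub>v v = 0\<^sub>v (4 * q2)"
    using det_0_iff_vec_prod_zero[OF Ac] by auto
  define a where "a = (\<Sum>s<N. monom (v $ s) s)"
  define b where "b = (\<Sum>s<N. monom (v $ (N + s)) s)"
  have F0: "F \<noteq> 0" using deg n by (auto simp: F_def)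
  have cmul: "coeff (monom u s * H) j = (if s \<le> j then u * coeff H (j - s) else 0)"
    for u :: complex and H s j by (simp add: coeff_monom_mult)
  have "coeff (a * F + b * G) j = 0" for j
  proof (cases "j < 4 * q2")
    case True
    have "(A *\<^sub>v v) $ j = (\<Sum>r<4 * q2. A $$ (j, r) * v $ r)"
      using True Ac v(1) by (auto simp: scalar_prod_def atLeast0LessThan intro!: sum.cong)
    also have "\<dots> = (\<Sum>r<N. A $$ (j, r) * v $ r) + (\<Sum>r\<in>{N..<4 * q2}. A $$ (j, r) * v $ r)"
      by (subst sum.union_disjoint[symmetric]) (auto intro!: sum.cong simp: N_def)
    also have "(\<Sum>r\<in>{N..<4 * q2}. A $$ (j, r) * v $ r) = (\<Sum>s<N. A $$ (j, N + s) * v $ (N + s))"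
      by (rule sum.reindex_bij_witness[of _ "\<lambda>s. N + s" "\<lambda>r. r - N"]) (auto simp: N_def)
    also have "(\<Sum>r<N. A $$ (j, r) * v $ r) = coeff (a * F) j"
      unfolding a_def sum_distrib_right coeff_sum cmul using True
      by (intro sum.cong) (auto simp: A_def sylvester_def poly_sylvester_entry F_def N_def)
    also have "(\<Sum>s<N. A $$ (j, N + s) * v $ (N + s)) = coeff (b * G) j"
      unfolding b_def sum_distrib_right coeff_sum cmul using True
      by (intro sum.cong) (auto simp: A_def sylvester_def poly_sylvester_entry G_def N_def)
    finally show ?thesis using Av True by simp
  next
    \<comment> \<open>Both products have degree below \<open>4 * q2\<close>, so the rows of the
      matrix account for every coefficient.\<close>
    case False
    have cF: "coeff F i = 0" "coeff G i = 0" if "i > N" for i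
      using that by (auto simp: F_def G_def coeff_fibre_poly N_def)
    show ?thesis unfolding a_def b_def coeff_add sum_distrib_right coeff_sum cmul
      using False by (auto intro!: sum.neutral simp: N_def cF)
  qed
  then have eq: "a * F + b * G = 0" by (simp add: poly_eq_iff)
  have "coprime F G" using coprime_poly_complex[OF F0] nz by (auto simp: F_def G_def)
  moreover have "F dvd b * G" using eq
    by (metis dvd_triv_right eq_neg_iff_add_eq_0 dvd_minus_iff)
  ultimately have "F dvd b" by (simp add: coprime_dvd_mult_left_iff)
  have "b = 0"
  proof (rule ccontr)
    assume "b \<noteq> 0"
    then have "2 * q2 \<le> degree b" using \<open>F dvd b\<close> dvd_imp_degree_le deg F_def by metis
    moreover have "degree b \<le> 2 * q2 - 1"
      by (rule degree_le) (auto simp: b_def N_def coeff_sum intro!: sum.neutral)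
    ultimately show False using n by simp
  qed
  with eq F0 have "a = 0" by simp
  have ca: "coeff a r = v $ r" if "r < N" for r
    using that unfolding a_def coeff_sum by (simp add: sum.delta)
  have cb: "coeff b r = v $ (N + r)" if "r < N" for r
    using that unfolding b_def coeff_sum by (simp add: sum.delta)
  have "v $ r = 0" if "r < 4 * q2" for r
  proof (cases "r < N")
    case True
    then show ?thesis using ca \<open>a = 0\<close> by fastforce
  next
    case False
    then have "r - N < N" using that by (simp add: N_def)
    then show ?thesis using cb[of "r - N"] \<open>b = 0\<close> False by simp
  qed
  then have "v = 0\<^sub>v (4 * q2)" using v(1) by auto
  then show False using v(2) by simp
qed

subsection \<open>Multiplicities of the roots of the resultant\<close>

lemma det_vandermonde_nonzero:
  fixes xs :: "complex list"
  assumes "distinct xs"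
  shows "det (mat (length xs) (length xs) (\<lambda>(l, j). xs ! l ^ j)) \<noteq> 0"
proof
  define n where "n = length xs"
  define A where "A = mat n n (\<lambda>(l, j). xs ! l ^ j)"
  have Ac: "A \<in> carrier_mat n n" by (simp add: A_def)
  assume "det (mat (length xs) (length xs) (\<lambda>(l, j). xs ! l ^ j)) = 0"
  then obtain v where v: "v \<in> carrier_vec n" "v \<noteq> 0\<^sub>v n" and Av: "A *\<^sub>v v = 0\<^sub>v n"
    using det_0_iff_vec_prod_zero[OF Ac] by (auto simp: A_def n_def)
  define f where "f = (\<Sum>j<n. monom (v $ j) j)"
  have cf: "coeff f j = v $ j" if "j < n" for j
    using that unfolding f_def coeff_sum by (simp add: sum.delta)
  have "poly f (xs ! l) = 0" if l: "l < n" for l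
  proof -
    have "(A *\<^sub>v v) $ l = (\<Sum>j<n. xs ! l ^ j * v $ j)"
      using l v(1) by (auto simp: A_def scalar_prod_def atLeast0LessThan intro!: sum.cong)
    then show ?thesis using Av l
      by (simp add: f_def poly_sum poly_monom mult.commute)
  qed
  then have roots: "set xs \<subseteq> {x. poly f x = 0}" by (auto simp: in_set_conv_nth n_def)
  have "f = 0"
  proof (rule ccontr)
    assume "f \<noteq> 0"
    then have fin: "finite {x. poly f x = 0}" by (rule poly_roots_finite)
    have "n = card (set xs)" using assms by (simp add: n_def distinct_card)
    also have "\<dots> \<le> card {x. poly f x = 0}" using roots fin by (rule card_mono[rotated])
    also have "\<dots> \<le> degree f" using \<open>f \<noteq> 0\<close> by (rule card_poly_roots_bound)
    finally have "n \<le> degree f" .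
    moreover have "n > 0"
      using v by (metis gr0I carrier_vecD eq_vecI index_zero_vec(2) less_nat_zero_code)
    moreover have "degree f \<le> n - 1"
      by (rule degree_le) (auto simp: f_def coeff_sum intro!: sum.neutral)
    ultimately show False by simp
  qed
  then have "v $ j = 0" if "j < n" for j using cf[OF that] by simp
  then have "v = 0\<^sub>v n" using v(1) by auto
  then show False using v(2) by simp
qed

text \<open>Every Leibniz product contains one entry from each of the first r rows.\<close>

lemma det_rows_dvd:
  fixes A :: "'a :: idom mat"
  assumes A: "A \<in> carrier_mat n n" and r: "r \<le> n"
    and dvd: "\<And>i j. i < r \<Longrightarrow> j < n \<Longrightarrow> d dvd A $$ (i, j)"
  shows "d ^ r dvd det A"
proof -
  have "d ^ r dvd (\<Prod>i = 0..<n. A $$ (i, f i))" if f: "f permutes {0..<n}" for f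
  proof -
    have "(\<Prod>i\<in>{0..<r}. d) dvd (\<Prod>i\<in>{0..<r}. A $$ (i, f i))"
      using r permutes_in_image[OF f] by (intro prod_dvd_prod dvd) auto
    moreover have "(\<Prod>i\<in>{0..<r}. A $$ (i, f i)) dvd (\<Prod>i = 0..<n. A $$ (i, f i))"
      using r by (intro prod_dvd_prod_subset) auto
    ultimately have "(\<Prod>i\<in>{0..<r}. d) dvd (\<Prod>i = 0..<n. A $$ (i, f i))" by (rule dvd_trans)
    then show ?thesis by simp
  qed
  then show ?thesis unfolding det_def'[OF A] by (intro dvd_sum dvd_mult) auto
qed

text \<open>Left multiplication by a constant Vandermonde matrix whose first nodes are the common
  zeros makes that many rows divisible by the linear factor at c. The Vandermonde determinant is a
  nonzero constant, so the order of the determinant at c is unchanged.\<close>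

lemma card_common_roots_le_order:
  assumes R: "det (sylvester q1 q2 g h) \<noteq> 0"
    and Z: "Z \<subseteq> {x. poly (fibre_poly q1 q2 g c) x = 0 \<and> poly (fibre_poly q1 q2 h c) x = 0}"
    and fin: "finite Z" and card: "card Z \<le> 4 * q2"
  shows "card Z \<le> order c (det (sylvester q1 q2 g h))"
proof -
  define N where "N = 4 * q2"
  define S where "S = sylvester q1 q2 g h"
  obtain zs where zs: "set zs = Z" "distinct zs" using fin finite_distinct_list by blast
  have len: "length zs = card Z" using zs distinct_card by fastforce
  \<comment> \<open>Arbitrary further nodes, distinct from the common zeros, fill the Vandermonde
    matrix up to size N.\<close>
  have "infinite (UNIV - Z)" using fin infinite_UNIV_char_0 by auto
  then obtain Y where Y: "finite Y" "card Y = N - card Z" "Y \<subseteq> UNIV - Z"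
    using infinite_arbitrarily_large by metis
  obtain ys where ys: "set ys = Y" "distinct ys" using Y finite_distinct_list by blast
  have leny: "length ys = N - card Z" using ys Y distinct_card by fastforce
  define xs where "xs = zs @ ys"
  have xs: "distinct xs" "length xs = N"
    using zs ys Y len leny card by (auto simp: xs_def N_def)
  have xsZ: "xs ! l \<in> Z" if "l < card Z" for l
    using that zs len by (auto simp: xs_def nth_append)
  define W where "W = mat N N (\<lambda>(l, j). [:xs ! l ^ j:])"
  have Wc: "W \<in> carrier_mat N N" and Sc: "S \<in> carrier_mat N N"
    by (simp_all add: W_def S_def sylvester_def N_def)
  have detW: "poly (det W) c \<noteq> 0"
  proof -
    have "poly (det W) c = det (mat N N (\<lambda>(l, j). xs ! l ^ j))"
      by (rule poly_det_cong[of _ N]) (auto simp: W_def)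
    then show ?thesis using det_vandermonde_nonzero[OF xs(1)] xs(2) by simp
  qed
  have "[:- c, 1:] dvd (W * S) $$ (l, r)" if l: "l < card Z" and r: "r < N" for l r
  proof -
    have lN: "l < N" using l card by (simp add: N_def)
    have "(W * S) $$ (l, r) = (\<Sum>j<N. [:xs ! l ^ j:] * S $$ (j, r))"
      using lN r Wc Sc
      by (auto simp: scalar_prod_def W_def atLeast0LessThan intro!: sum.cong)
    then have "poly ((W * S) $$ (l, r)) c = (\<Sum>j<N. xs ! l ^ j * poly (S $$ (j, r)) c)"
      by (simp add: poly_sum)
    also have "\<dots> = 0"
    proof (cases "r < 2 * q2")
      case True
      have "(\<Sum>j<N. xs ! l ^ j * poly (S $$ (j, r)) c) =
          (\<Sum>j<4 * q2. xs ! l ^ j * poly (sylvester_entry q1 q2 g r j) c)"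
        using True r by (intro sum.cong) (auto simp: S_def sylvester_def N_def)
      then show ?thesis using sum_poly_sylvester_entry[OF True] xsZ[OF l] Z by auto
    next
      case False
      then have r': "r - 2 * q2 < 2 * q2" using r by (simp add: N_def)
      have "(\<Sum>j<N. xs ! l ^ j * poly (S $$ (j, r)) c) =
          (\<Sum>j<4 * q2. xs ! l ^ j * poly (sylvester_entry q1 q2 h (r - 2 * q2) j) c)"
        using False r by (intro sum.cong) (auto simp: S_def sylvester_def N_def)
      then show ?thesis using sum_poly_sylvester_entry[OF r'] xsZ[OF l] Z by auto
    qed
    finally show ?thesis by (simp add: poly_eq_0_iff_dvd)
  qed
  then have "[:- c, 1:] ^ card Z dvd det (W * S)"
    using Wc Sc card by (intro det_rows_dvd[of _ N]) (auto simp: N_def)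
  also have "det (W * S) = det W * det S" by (rule det_mult[OF Wc Sc])
  finally have dvd: "[:- c, 1:] ^ card Z dvd det W * det S" .
  have nz: "det W * det S \<noteq> 0" using detW R by (auto simp: S_def)
  then have "card Z \<le> order c (det W * det S)" using dvd by (simp add: order_divides)
  also have "\<dots> = order c (det S)" using nz detW by (simp add: order_mult order_0I)
  finally show ?thesis by (simp add: S_def)
qed

subsection \<open>Degree of the resultant\<close>

text \<open>Everything is scaled by \<open>q2\<close>, because the sides of the diamond have slope
  \<open>q1 / q2\<close>: the exponents lie within h / q2 of c / q2. In this form centres and radii
  are integers and simply add under multiplication.\<close>

definition exponents_within :: "nat \<Rightarrow> complex poly \<Rightarrow> int \<Rightarrow> int \<Rightarrow> bool" where
  "exponents_within q2 f c h \<longleftrightarrow> (\<forall>n. coeff f n \<noteq> 0 \<longrightarrow> \<bar>int q2 * int n - c\<bar> \<le> h)"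

lemma exponents_within_mult:
  assumes "exponents_within q2 f c h" "exponents_within q2 f' c' h'"
  shows "exponents_within q2 (f * f') (c + c') (h + h')"
  unfolding exponents_within_def
proof (intro allI impI)
  fix n assume "coeff (f * f') n \<noteq> 0"
  then have "(\<Sum>i\<le>n. coeff f i * coeff f' (n - i)) \<noteq> 0" by (simp add: coeff_mult)
  then obtain i where i: "i \<le> n" "coeff f i \<noteq> 0" "coeff f' (n - i) \<noteq> 0"
    by (metis (no_types, lifting) atMost_iff mult_eq_0_iff sum.neutral)
  have "\<bar>int q2 * int i - c\<bar> \<le> h" "\<bar>int q2 * int (n - i) - c'\<bar> \<le> h'"
    using assms i by (auto simp: exponents_within_def)
  moreover have "int q2 * int n = int q2 * int i + int q2 * int (n - i)"
    using i(1) by (simp add: of_nat_diff algebra_simps)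
  ultimately show "\<bar>int q2 * int n - (c + c')\<bar> \<le> h + h'" by linarith
qed

lemma exponents_within_prod:
  assumes "finite I" "\<And>i. i \<in> I \<Longrightarrow> exponents_within q2 (f i) (c i) (h i)"
  shows "exponents_within q2 (\<Prod>i\<in>I. f i) (\<Sum>i\<in>I. c i) (\<Sum>i\<in>I. h i)"
  using assms
proof (induction I rule: finite_induct)
  case empty
  then show ?case by (auto simp: exponents_within_def)
next
  case (insert i I)
  then show ?case by (auto intro!: exponents_within_mult)
qed

lemma exponents_within_sum:
  assumes "\<And>i. i \<in> I \<Longrightarrow> exponents_within q2 (f i) c h"
  shows "exponents_within q2 (\<Sum>i\<in>I. f i) c h"
  unfolding exponents_within_def coeff_sum
proof (intro allI impI)
  fix n assume "(\<Sum>i\<in>I. coeff (f i) n) \<noteq> 0"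
  then obtain i where "i \<in> I" "coeff (f i) n \<noteq> 0" by (meson sum.neutral)
  then show "\<bar>int q2 * int n - c\<bar> \<le> h" using assms by (auto simp: exponents_within_def)
qed

text \<open>The function \<open>j \<mapsto> \<bar>j - 2 * q2\<bar>\<close> is an optimal Kantorovich potential for the assignment problem
  that gives the degree of the determinant.\<close>

lemma exponents_within_sylvester_entry:
  assumes gs: "\<And>a b. g a b \<noteq> 0 \<Longrightarrow> int q1 * \<bar>a\<bar> + int q2 * \<bar>b\<bar> \<le> int (q1 * q2)"
  shows "exponents_within q2 (sylvester_entry q1 q2 g s j) (int (q1 * q2))
    (int q1 * (int q2 - \<bar>int j - 2 * int q2\<bar> + \<bar>int s - int q2\<bar>))"
  unfolding exponents_within_def
proof (intro allI impI)
  fix n assume nz: "coeff (sylvester_entry q1 q2 g s j) n \<noteq> 0"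
  then have sj: "s \<le> j" and n: "g (int (j - s) - int q2) (int n - int q1) \<noteq> 0"
    by (auto simp: sylvester_entry_def coeff_coeff_poly split: if_splits)
  \<comment> \<open>The triangle inequality for j - s - q2, written as the difference of j - 2 * q2
    and s - q2, separates the row from the column.\<close>
  have "int q1 * (\<bar>int j - 2 * int q2\<bar> - \<bar>int s - int q2\<bar>) \<le> int q1 * \<bar>int (j - s) - int q2\<bar>"
    using sj by (intro mult_left_mono) auto
  moreover have "int q2 * \<bar>int n - int q1\<bar> = \<bar>int q2 * int n - int (q1 * q2)\<bar>"
  proof -
    have "int q2 * \<bar>int n - int q1\<bar> = \<bar>int q2 * (int n - int q1)\<bar>"
      by (simp only: abs_mult abs_of_nat)
    then show ?thesis by (simp only: right_diff_distrib of_nat_mult mult.commute)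
  qed
  ultimately show "\<bar>int q2 * int n - int (q1 * q2)\<bar>
      \<le> int q1 * (int q2 - \<bar>int j - 2 * int q2\<bar> + \<bar>int s - int q2\<bar>)"
    using gs[OF n] by (simp add: algebra_simps)
qed

lemma sum_abs_shift: "(\<Sum>s<2 * n. \<bar>int s - int n\<bar>) = int n * int n"
proof -
  have *: "(\<Sum>s<n. int s) + (\<Sum>s<n. int s) = int n * int n - int n" for n
    by (induction n) (auto simp: algebra_simps)
  have "(\<Sum>s<2 * n. \<bar>int s - int n\<bar>) = (\<Sum>s<n. \<bar>int s - int n\<bar>) + (\<Sum>s\<in>{n..<2 * n}. \<bar>int s - int n\<bar>)"
    by (subst sum.union_disjoint[symmetric]) (auto intro!: sum.cong)
  also have "(\<Sum>s\<in>{n..<2 * n}. \<bar>int s - int n\<bar>) = (\<Sum>s<n. int s)"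
    by (rule sum.reindex_bij_witness[of _ "\<lambda>s. n + s" "\<lambda>s. s - n"]) auto
  also have "(\<Sum>s<n. \<bar>int s - int n\<bar>) = (\<Sum>s<n. int n - int s)"
    by (intro sum.cong) auto
  also have "\<dots> = int n * int n - (\<Sum>s<n. int s)" by (simp add: sum_subtractf)
  finally show ?thesis by simp
qed

text \<open>The radius of an entry is a function of its row plus a function of its column, so its
  sum is the same along every permutation, namely
  \<open>q1 * (4 * q2 ^ 2 - 4 * q2 ^ 2 + 2 * q2 ^ 2)\<close>. After division by the scale
  \<open>q2\<close>, the exponents lie within \<open>2 * q1 * q2\<close> of
  \<open>4 * q1 * q2\<close>.\<close>

lemma exponents_within_det_sylvester:
  assumes g: "\<And>a b. g a b \<noteq> 0 \<Longrightarrow> int q1 * \<bar>a\<bar> + int q2 * \<bar>b\<bar> \<le> int (q1 * q2)"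
    and h: "\<And>a b. h a b \<noteq> 0 \<Longrightarrow> int q1 * \<bar>a\<bar> + int q2 * \<bar>b\<bar> \<le> int (q1 * q2)"
  shows "exponents_within q2 (det (sylvester q1 q2 g h))
    (4 * int q2 * int (q1 * q2)) (2 * int q2 * int (q1 * q2))"
proof -
  define N where "N = 4 * q2"
  define S where "S = sylvester q1 q2 g h"
  define sh where "sh r = (if r < 2 * q2 then r else r - 2 * q2)" for r
  define w where "w j r = int q1 * (int q2 - \<bar>int j - 2 * int q2\<bar> + \<bar>int (sh r) - int q2\<bar>)" for j r
  have Sc: "S \<in> carrier_mat N N" by (simp add: S_def sylvester_def N_def)
  have ent: "exponents_within q2 (S $$ (j, r)) (int (q1 * q2)) (w j r)" if "j < N" "r < N" for j r
    using that exponents_within_sylvester_entry[of g q1 q2 r j, OF g]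
      exponents_within_sylvester_entry[of h q1 q2 "r - 2 * q2" j, OF h]
    by (auto simp: S_def sylvester_def N_def w_def sh_def)
  have sumw: "(\<Sum>j\<in>{0..<N}. w j (f j)) = 2 * int q2 * int (q1 * q2)"
    if f: "f permutes {0..<N}" for f
  proof -
    have "(\<Sum>j\<in>{0..<N}. \<bar>int (sh (f j)) - int q2\<bar>) = (\<Sum>r\<in>{0..<N}. \<bar>int (sh r) - int q2\<bar>)"
      using sum.permute[OF f, of "\<lambda>r. \<bar>int (sh r) - int q2\<bar>"] by (simp add: o_def)
    also have "\<dots> = (\<Sum>r<2 * q2. \<bar>int (sh r) - int q2\<bar>) + (\<Sum>r\<in>{2 * q2..<N}. \<bar>int (sh r) - int q2\<bar>)"
      by (subst sum.union_disjoint[symmetric]) (auto intro!: sum.cong simp: N_def)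
    also have "(\<Sum>r\<in>{2 * q2..<N}. \<bar>int (sh r) - int q2\<bar>) = (\<Sum>s<2 * q2. \<bar>int s - int q2\<bar>)"
      by (rule sum.reindex_bij_witness[of _ "\<lambda>s. 2 * q2 + s" "\<lambda>r. r - 2 * q2"])
        (auto simp: N_def sh_def)
    also have "(\<Sum>r<2 * q2. \<bar>int (sh r) - int q2\<bar>) = (\<Sum>s<2 * q2. \<bar>int s - int q2\<bar>)"
      by (intro sum.cong) (auto simp: sh_def)
    finally have 1: "(\<Sum>j\<in>{0..<N}. \<bar>int (sh (f j)) - int q2\<bar>) = 2 * (int q2 * int q2)"
      by (simp add: sum_abs_shift)
    have 2: "(\<Sum>j\<in>{0..<N}. \<bar>int j - 2 * int q2\<bar>) = 4 * (int q2 * int q2)"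
      using sum_abs_shift[of "2 * q2"] by (simp add: N_def atLeast0LessThan)
    have "(\<Sum>j\<in>{0..<N}. w j (f j)) = int q1 * (int N * int q2 -
        (\<Sum>j\<in>{0..<N}. \<bar>int j - 2 * int q2\<bar>) + (\<Sum>j\<in>{0..<N}. \<bar>int (sh (f j)) - int q2\<bar>))"
      unfolding w_def sum_distrib_left[symmetric] by (simp add: sum.distrib sum_subtractf)
    then show ?thesis unfolding 1 2 by (simp add: N_def algebra_simps)
  qed
  have "exponents_within q2 (signof f * (\<Prod>j = 0..<N. S $$ (j, f j)))
      (4 * int q2 * int (q1 * q2)) (2 * int q2 * int (q1 * q2))" if f: "f permutes {0..<N}" for f
  proof -
    have "exponents_within q2 (\<Prod>j = 0..<N. S $$ (j, f j))
        (\<Sum>j\<in>{0..<N}. int (q1 * q2)) (\<Sum>j\<in>{0..<N}. w j (f j))"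
      using permutes_in_image[OF f] by (intro exponents_within_prod ent) auto
    then have 1: "exponents_within q2 (\<Prod>j = 0..<N. S $$ (j, f j))
      (4 * int q2 * int (q1 * q2)) (2 * int q2 * int (q1 * q2))"
      unfolding sumw[OF f] by (simp add: N_def)
    then show ?thesis
      by (cases f rule: sign_cases) (simp_all add: exponents_within_def)
  qed
  then show ?thesis unfolding S_def[symmetric] det_def'[OF Sc]
    by (intro exponents_within_sum) auto
qed

lemma sum_order_le_degree:
  fixes f :: "'a :: idom poly"
  assumes "f \<noteq> 0" and "finite C"
  shows "(\<Sum>c\<in>C. order c f) \<le> degree f"
proof -
  have "(\<Sum>c\<in>C. order c f) = (\<Sum>c\<in>C \<inter> {x. poly f x = 0}. order c f)"
    using assms by (intro sum.mono_neutral_right) (auto simp: order_root)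
  also have "\<dots> \<le> (\<Sum>c\<in>{x. poly f x = 0}. order c f)"
    using poly_roots_finite[OF assms(1)] by (intro sum_mono2) auto
  also have "\<dots> = size (proots f)"
    using assms by (simp add: size_multiset_overloaded_eq)
  finally show ?thesis using size_proots_le[of f] by simp
qed

section \<open>Counting the common zeros in the torus\<close>

context newton_diamond
begin

text \<open>The zeros are fibred over z. The fibre over c has at most \<open>order c R\<close>
  points, and the orders at nonzero c add up to at most the degree of R minus its order at 0, that
  is 6 - 2 = 4 times \<open>q1 * q2\<close>.\<close>

lemma card_torus_singular_points:
  defines "h \<equiv> \<lambda>a b. of_int a * p a b"
  defines "Z \<equiv> {(x, z). x \<noteq> 0 \<and> z \<noteq> 0 \<and> laurent2 q1 q2 p x z = 0 \<and> laurent2 q1 q2 h x z = 0}"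
  shows "finite Z \<and> card Z \<le> 4 * q1 * q2"
proof -
  define R where "R = det (sylvester q1 q2 p h)"
  define F where "F = fibre_poly q1 q2 p"
  define H where "H = fibre_poly q1 q2 h"
  have hs: "int q1 * \<bar>a\<bar> + int q2 * \<bar>b\<bar> \<le> int (q1 * q2)" if "h a b \<noteq> 0" for a b
    using that supp by (simp add: h_def)
  \<comment> \<open>The diamond meets the lines a = -q2 and a = q2 only in vertices, so the extreme
    coefficients in x are single monomials in z. Hence over every nonzero c the fibre polynomial has
    full degree and no root at x = 0.\<close>
  have edge0: "p (- int q2) b = 0" "p (int q2) b = 0" if "b \<noteq> 0" for b
    using supp[of "- int q2" b] supp[of "int q2" b] that q2_pos by (auto simp: mult_le_0_iff)
  have outer: "poly (coeff_poly q1 q2 p 0) c \<noteq> 0" "poly (coeff_poly q1 q2 p (2 * q2)) c \<noteq> 0"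
    if c: "c \<noteq> 0" for c
  proof -
    have "(\<Sum>b\<in>{- int q1..int q1}. p (- int q2) b * c powi b) = p (- int q2) 0"
      by (subst sum.remove[of _ 0]) (auto simp: edge0 intro!: sum.neutral)
    moreover have "(\<Sum>b\<in>{- int q1..int q1}. p (int q2) b * c powi b) = p (int q2) 0"
      by (subst sum.remove[of _ 0]) (auto simp: edge0 intro!: sum.neutral)
    ultimately show "poly (coeff_poly q1 q2 p 0) c \<noteq> 0" "poly (coeff_poly q1 q2 p (2 * q2)) c \<noteq> 0"
      using c vertex_left vertex_right by (simp_all add: poly_coeff_poly)
  qed
  have degF: "degree (F c) = 2 * q2" if "c \<noteq> 0" for c
  proof (rule antisym)
    show "degree (F c) \<le> 2 * q2"
      by (rule degree_le) (auto simp: F_def coeff_fibre_poly)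
    show "2 * q2 \<le> degree (F c)"
      using outer[OF that] by (intro le_degree) (auto simp: F_def coeff_fibre_poly)
  qed
  have F0: "poly (F c) 0 \<noteq> 0" if "c \<noteq> 0" for c
    using outer[OF that] by (simp add: poly_0_coeff_0 F_def coeff_fibre_poly)
  have R0: "R \<noteq> 0"
  proof -
    obtain c where c: "c \<noteq> 0" "\<And>x. x \<noteq> 0 \<Longrightarrow> laurent2 q1 q2 p x c = 0 \<Longrightarrow> laurent2 q1 q2 h x c \<noteq> 0"
      using exists_fibre_without_common_zero unfolding h_def by blast
    have "poly (H c) x \<noteq> 0" if "poly (F c) x = 0" for x
    proof -
      have "x \<noteq> 0" using that F0[OF c(1)] by auto
      then show ?thesis using that c by (simp add: F_def H_def poly_fibre_poly)
    qed
    then show ?thesis unfolding R_def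
      using q2_pos degF[OF c(1)] by (intro det_sylvester_nonzero[where c = c]) (auto simp: F_def H_def)
  qed
  have within: "exponents_within q2 R (4 * int q2 * int (q1 * q2)) (2 * int q2 * int (q1 * q2))"
    unfolding R_def using supp hs by (rule exponents_within_det_sylvester)
  have expo: "2 * q1 * q2 \<le> n \<and> n \<le> 6 * q1 * q2" if "coeff R n \<noteq> 0" for n
  proof -
    have "\<bar>int q2 * int n - int q2 * (4 * int (q1 * q2))\<bar> \<le> int q2 * (2 * int (q1 * q2))"
      using within that by (simp add: exponents_within_def mult_ac)
    then have "int q2 * \<bar>int n - 4 * int (q1 * q2)\<bar> \<le> int q2 * (2 * int (q1 * q2))"
      by (simp only: right_diff_distrib[symmetric] abs_mult abs_of_nat)
    then have "\<bar>int n - 4 * int (q1 * q2)\<bar> \<le> 2 * int (q1 * q2)"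
      using q2_pos by (simp add: mult_le_cancel_left del: of_nat_mult)
    then show ?thesis by (simp add: abs_le_iff mult.assoc del: of_nat_mult)
  qed
  have deg: "degree R \<le> 6 * q1 * q2" using expo[of "degree R"] R0 by simp
  have ord0: "2 * q1 * q2 \<le> order 0 R"
  proof -
    have "coeff R k = 0" if "k < 2 * q1 * q2" for k using expo[of k] that by auto
    then have "monom 1 (2 * q1 * q2) dvd R" unfolding monom_1_dvd_iff' by blast
    then show ?thesis using R0 by (simp add: monom_1_dvd_iff)
  qed
  define fib where "fib c = {x. poly (F c) x = 0 \<and> poly (H c) x = 0}" for c
  have Fnz: "F c \<noteq> 0" if "c \<noteq> 0" for c using F0[OF that] by auto
  have fibfin: "finite (fib c)" if "c \<noteq> 0" for c
    using poly_roots_finite[OF Fnz[OF that]] by (auto simp: fib_def)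
  have fibcard: "card (fib c) \<le> order c R" if "c \<noteq> 0" for c
  proof -
    have "card (fib c) \<le> card {x. poly (F c) x = 0}"
      using poly_roots_finite[OF Fnz[OF that]] by (intro card_mono) (auto simp: fib_def)
    also have "\<dots> \<le> 2 * q2" using card_poly_roots_bound[OF Fnz[OF that]] degF[OF that] by simp
    finally show ?thesis unfolding R_def
      using R0 fibfin[OF that]
      by (intro card_common_roots_le_order) (auto simp: fib_def F_def H_def R_def)
  qed
  define C where "C = {c. c \<noteq> 0 \<and> poly R c = 0}"
  have Cfin: "finite C" using poly_roots_finite[OF R0] by (auto simp: C_def)
  have "prod.swap ` Z \<subseteq> Sigma C fib"
  proof (clarsimp simp: Z_def)
    fix x z assume xz: "x \<noteq> 0" "z \<noteq> 0" "laurent2 q1 q2 p x z = 0" "laurent2 q1 q2 h x z = 0"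
    then have x: "x \<in> fib z" by (simp add: fib_def F_def H_def poly_fibre_poly)
    then have "card (fib z) > 0" using fibfin[OF xz(2)] card_gt_0_iff by blast
    then have "order z R > 0" using fibcard[OF xz(2)] by linarith
    then have "poly R z = 0" using R0 by (simp add: order_root)
    then show "z \<in> C \<and> x \<in> fib z" using x xz by (simp add: C_def)
  qed
  moreover have fs: "finite (Sigma C fib)" using Cfin fibfin by (auto simp: C_def)
  ultimately have "finite (prod.swap ` Z)" and "card (prod.swap ` Z) \<le> card (Sigma C fib)"
    by (rule finite_subset, rule card_mono[rotated])
  then have Zfin: "finite Z" and "card Z \<le> card (Sigma C fib)"
    using inj_swap[of Z] by (simp_all only: card_image finite_image_iff)
  note this(2)
  also have "\<dots> = (\<Sum>c\<in>C. card (fib c))"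
    using Cfin fibfin by (intro card_SigmaI) (auto simp: C_def)
  also have "\<dots> \<le> (\<Sum>c\<in>C. order c R)" by (intro sum_mono fibcard) (auto simp: C_def)
  \<comment> \<open>The root 0 lies outside the torus; its order is included in the sum so that it
    can be subtracted from the degree.\<close>
  finally have "card Z + order 0 R \<le> (\<Sum>c\<in>insert 0 C. order c R)"
    using Cfin by (subst sum.insert) (auto simp: C_def)
  also have "\<dots> \<le> degree R" using R0 Cfin by (intro sum_order_le_degree) auto
  finally have "card Z \<le> 4 * q1 * q2" using deg ord0 by linarith
  with Zfin show ?thesis by blast
qed

end

section \<open>The characteristic polynomial as a Laurent polynomial\<close>

text \<open>This collects like terms. The box condition places every term with nonzero coefficient
  inside the range of summation of \<open>laurent2\<close>.\<close>

lemma laurent2_sum_monomials: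
  fixes c :: "'t \<Rightarrow> complex" and A B :: "'t \<Rightarrow> int"
  assumes "finite T"
    and box: "\<And>t. t \<in> T \<Longrightarrow> c t \<noteq> 0 \<Longrightarrow> \<bar>A t\<bar> \<le> int q2 \<and> \<bar>B t\<bar> \<le> int q1"
  shows "laurent2 q1 q2 (\<lambda>a b. \<Sum>t\<in>T. if (A t, B t) = (a, b) then c t else 0) x z =
    (\<Sum>t\<in>T. c t * x powi A t * z powi B t)"
proof -
  define X where "X = {- int q2..int q2} \<times> {- int q1..int q1}"
  have "laurent2 q1 q2 (\<lambda>a b. \<Sum>t\<in>T. if (A t, B t) = (a, b) then c t else 0) x z =
      (\<Sum>y\<in>X. \<Sum>t\<in>T. if y = (A t, B t) then c t * x powi A t * z powi B t else 0)"
    unfolding laurent2_def X_def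
    by (intro sum.cong refl) (auto simp: sum_distrib_right intro!: sum.cong)
  also have "\<dots> = (\<Sum>t\<in>T. \<Sum>y\<in>X. if y = (A t, B t) then c t * x powi A t * z powi B t else 0)"
    by (rule sum.swap)
  also have "\<dots> = (\<Sum>t\<in>T. c t * x powi A t * z powi B t)"
  proof (rule sum.cong[OF refl])
    fix t assume t: "t \<in> T"
    show "(\<Sum>y\<in>X. if y = (A t, B t) then c t * x powi A t * z powi B t else 0) =
        c t * x powi A t * z powi B t"
      using box[OF t] by (subst sum.delta) (auto simp: X_def abs_le_iff)
  qed
  finally show ?thesis .
qed

lemma prod_power_int:
  fixes x :: "'a :: field"
  assumes "x \<noteq> 0"
  shows "(\<Prod>i\<in>I. x powi f i) = x powi (\<Sum>i\<in>I. f i)"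
  using assms by (induction I rule: infinite_finite_induct) (auto simp: power_int_add)

section \<open>Hops between sites and the permutations they induce\<close>

definition hops :: "(int \<times> int) set" where
  "hops = insert (0, 0) (set nbr_offsets)"

text \<open>The hop d leads from site i to a translate of site j by whole periods. The numbers of
  periods, \<open>wrap1\<close> and \<open>wrap2\<close>, become the exponents of x and z.\<close>

definition wraps :: "nat \<Rightarrow> nat \<Rightarrow> nat \<Rightarrow> nat \<Rightarrow> int \<times> int \<Rightarrow> bool" where
  "wraps q1 q2 i j d \<longleftrightarrow>
     (fst (site q1 i) + fst d - fst (site q1 j)) mod int q1 = 0 \<and>
     (snd (site q1 i) + snd d - snd (site q1 j)) mod int q2 = 0"

definition wrap1 :: "nat \<Rightarrow> nat \<Rightarrow> nat \<Rightarrow> int \<times> int \<Rightarrow> int" where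
  "wrap1 q1 i j d = (fst (site q1 i) + fst d - fst (site q1 j)) div int q1"

definition wrap2 :: "nat \<Rightarrow> nat \<Rightarrow> nat \<Rightarrow> nat \<Rightarrow> int \<times> int \<Rightarrow> int" where
  "wrap2 q1 q2 i j d = (snd (site q1 i) + snd d - snd (site q1 j)) div int q2"

text \<open>These are the coefficients of \<mu> minus the Floquet matrix; the diagonal is treated as
  the hop (0, 0), so that each entry is one sum over \<open>hops\<close>. If \<open>q1\<close> or
  \<open>q2\<close> is at most 2, several hops may join the same two sites, hence a sum and not a
  case distinction. The multipliers are kept apart, so one family of coefficients serves all
  k.\<close>

definition hop_weight ::
  "nat \<Rightarrow> nat \<Rightarrow> (int \<times> int \<Rightarrow> real) \<Rightarrow> complex \<Rightarrow> nat \<Rightarrow> nat \<Rightarrow> int \<times> int \<Rightarrow> complex" where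
  "hop_weight q1 q2 V \<mu> i j d =
     (if wraps q1 q2 i j d then if d = (0, 0) then \<mu> - of_real (V (site q1 i)) else - 1 else 0)"

lemma wraps_mult:
  assumes "wraps q1 q2 i j d"
  shows "int q1 * wrap1 q1 i j d = fst (site q1 i) + fst d - fst (site q1 j)"
    and "int q2 * wrap2 q1 q2 i j d = snd (site q1 i) + snd d - snd (site q1 j)"
  using assms by (auto simp: wraps_def wrap1_def wrap2_def)

text \<open>The index in \<open>{0..<q1 * q2}\<close> of the fundamental-cell representative of \<open>site q1 i + d\<close>.\<close>

definition shift_index :: "nat \<Rightarrow> nat \<Rightarrow> int \<times> int \<Rightarrow> nat \<Rightarrow> nat" where
  "shift_index q1 q2 d i =
     nat ((int (i mod q1) + fst d) mod int q1) + q1 * nat ((int (i div q1) + snd d) mod int q2)"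

lemma shift_index_lt:
  assumes "q1 > 0" "q2 > 0"
  shows "shift_index q1 q2 d i < q1 * q2"
proof -
  define u where "u = nat ((int (i mod q1) + fst d) mod int q1)"
  define w where "w = nat ((int (i div q1) + snd d) mod int q2)"
  have "u < q1" using assms by (simp add: u_def nat_less_iff)
  moreover have "w < q2" using assms by (simp add: w_def nat_less_iff)
  then have "w + 1 \<le> q2" by simp
  then have "q1 * (w + 1) \<le> q1 * q2" by (rule mult_le_mono2)
  ultimately have "u + q1 * w < q1 * q2" by simp
  then show ?thesis by (simp add: shift_index_def u_def w_def)
qed

lemma wraps_iff_shift_index:
  assumes q: "q1 > 0" "q2 > 0" and j: "j < q1 * q2"
  shows "wraps q1 q2 i j d \<longleftrightarrow> j = shift_index q1 q2 d i"
proof -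
  have mod_iff: "(a + 1 + b - (c + 1)) mod m = 0 \<longleftrightarrow> (a + b) mod m = c"
    if "0 \<le> c" "c < m" for a b c m :: int
  proof -
    have "(a + 1 + b - (c + 1)) mod m = 0 \<longleftrightarrow> (a + b) mod m = c mod m"
      by (simp add: mod_eq_dvd_iff dvd_eq_mod_eq_0 algebra_simps)
    then show ?thesis using that by simp
  qed
  have "j div q1 < q2" using j by (simp add: less_mult_imp_div_less mult.commute)
  then have "wraps q1 q2 i j d \<longleftrightarrow> (int (i mod q1) + fst d) mod int q1 = int (j mod q1) \<and>
      (int (i div q1) + snd d) mod int q2 = int (j div q1)"
    unfolding wraps_def site_def fst_conv snd_conv using q
    by (subst (1 2) mod_iff) auto
  also have "\<dots> \<longleftrightarrow> nat ((int (i mod q1) + fst d) mod int q1) = j mod q1 \<and>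
      nat ((int (i div q1) + snd d) mod int q2) = j div q1"
  proof -
    have "X mod int m = int n \<longleftrightarrow> nat (X mod int m) = n" if "m > 0" for X and m n :: nat
      using that pos_mod_sign[of "int m" X] by auto
    then show ?thesis using q by blast
  qed
  also have "\<dots> \<longleftrightarrow> j = shift_index q1 q2 d i"
  proof -
    define u where "u = nat ((int (i mod q1) + fst d) mod int q1)"
    define w where "w = nat ((int (i div q1) + snd d) mod int q2)"
    have u: "u < q1" using q by (simp add: u_def nat_less_iff)
    have "u = j mod q1 \<and> w = j div q1 \<longleftrightarrow> j = u + q1 * w" using u by auto
    then show ?thesis by (simp add: shift_index_def u_def w_def)
  qed
  finally show ?thesis .
qed

lemma shift_index_zero:
  assumes "q1 > 0" "i < q1 * q2"
  shows "shift_index q1 q2 (0, 0) i = i"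
proof -
  have "i div q1 < q2" using assms by (simp add: less_mult_imp_div_less mult.commute)
  then show ?thesis using assms by (simp add: shift_index_def nat_mod_distrib)
qed

lemma shift_index_inj:
  assumes q: "q1 > 0" "q2 > 0"
  shows "inj_on (shift_index q1 q2 d) {0..<q1 * q2}"
proof (rule inj_onI)
  fix i i' assume i: "i \<in> {0..<q1 * q2}" "i' \<in> {0..<q1 * q2}"
    and eq: "shift_index q1 q2 d i = shift_index q1 q2 d i'"
  define j where "j = shift_index q1 q2 d i"
  have j: "j < q1 * q2" using shift_index_lt[OF q, where d = d] by (simp add: j_def)
  have w: "wraps q1 q2 i j d" "wraps q1 q2 i' j d"
    using wraps_iff_shift_index[OF q j] eq by (simp_all add: j_def)
  have *: "(a + 0 - a') mod m = 0"
    if "(a + u - b) mod m = 0" "(a' + u - b) mod m = 0" for a a' b u m :: int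
  proof -
    have "m dvd (a + u - b) - (a' + u - b)" 
      using that unfolding dvd_eq_mod_eq_0[symmetric] by (rule dvd_diff)
    then show ?thesis by (simp add: dvd_eq_mod_eq_0)
  qed
  have "wraps q1 q2 i i' (0, 0)"
    unfolding wraps_def fst_conv snd_conv
  proof
    show "(fst (site q1 i) + 0 - fst (site q1 i')) mod int q1 = 0"
      by (rule *[of _ "fst d" "fst (site q1 j)"]) (use w[unfolded wraps_def] in blast)+
    show "(snd (site q1 i) + 0 - snd (site q1 i')) mod int q2 = 0"
      by (rule *[of _ "snd d" "snd (site q1 j)"]) (use w[unfolded wraps_def] in blast)+
  qed
  then have "i' = shift_index q1 q2 (0, 0) i" using wraps_iff_shift_index[OF q, where d = "(0, 0)"] i by simp
  then show "i = i'" using shift_index_zero[OF q(1)] i by simp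
qed

text \<open>This is translation of the discrete torus by d. For a unit step d it turns out to be the
  only permutation that contributes to the corresponding vertex.\<close>

lemma shift_index_permutes:
  assumes q: "q1 > 0" "q2 > 0"
  shows "(\<lambda>i. if i < q1 * q2 then shift_index q1 q2 d i else i) permutes {0..<q1 * q2}"
proof (rule bij_imp_permutes)
  have "inj_on (\<lambda>i. if i < q1 * q2 then shift_index q1 q2 d i else i) {0..<q1 * q2}"
    using shift_index_inj[OF q, of d] by (subst inj_on_cong[of _ _ "shift_index q1 q2 d"]) auto
  moreover have "(\<lambda>i. if i < q1 * q2 then shift_index q1 q2 d i else i) ` {0..<q1 * q2} \<subseteq> {0..<q1 * q2}"
    using shift_index_lt[OF q, where d = d] by auto
  ultimately show "bij_betw (\<lambda>i. if i < q1 * q2 then shift_index q1 q2 d i else i)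
      {0..<q1 * q2} {0..<q1 * q2}"
    unfolding bij_betw_def by (intro conjI endo_inj_surj finite_atLeastLessThan)
qed simp

lemma floquet_entry_hops:
  fixes k :: "real \<times> real"
  assumes q: "q1 > 0" "q2 > 0" and ij: "i < q1 * q2" "j < q1 * q2"
  defines "x \<equiv> exp (2 * of_real pi * \<i> * of_real (fst k))"
    and "z \<equiv> exp (2 * of_real pi * \<i> * of_real (snd k))"
  shows "(if i = j then \<mu> else 0) - floquet_matrix q1 q2 V k $$ (i, j) =
    (\<Sum>d\<in>hops. hop_weight q1 q2 V \<mu> i j d * x powi wrap1 q1 i j d * z powi wrap2 q1 q2 i j d)"
proof -
  have xz: "exp (2 * complex_of_real pi * \<i> * complex_of_real (fst k * of_int a + snd k * of_int b)) =
      x powi a * z powi b" for a b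
    unfolding x_def z_def exp_power_int exp_add[symmetric]
    by (rule arg_cong[where f = exp]) (simp add: algebra_simps)
  have diag: "wraps q1 q2 i j (0, 0) \<longleftrightarrow> i = j"
    using wraps_iff_shift_index[OF q ij(2)] shift_index_zero[OF q(1) ij(1)] by auto
  have off: "(if wraps q1 q2 i j d then x powi wrap1 q1 i j d * z powi wrap2 q1 q2 i j d else 0) =
      - (hop_weight q1 q2 V \<mu> i j d * x powi wrap1 q1 i j d * z powi wrap2 q1 q2 i j d)"
    if "d \<noteq> (0, 0)" for d using that by (simp add: hop_weight_def)
  have "floquet_matrix q1 q2 V k $$ (i, j) = (if i = j then of_real (V (site q1 i)) else 0) +
      (\<Sum>d\<leftarrow>nbr_offsets. if wraps q1 q2 i j d
         then x powi wrap1 q1 i j d * z powi wrap2 q1 q2 i j d else 0)"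
    using ij unfolding floquet_matrix_def wraps_def wrap1_def wrap2_def Let_def xz by simp
  also have "(\<Sum>d\<leftarrow>nbr_offsets. if wraps q1 q2 i j d
         then x powi wrap1 q1 i j d * z powi wrap2 q1 q2 i j d else 0) =
      - (\<Sum>d\<in>set nbr_offsets.
          hop_weight q1 q2 V \<mu> i j d * x powi wrap1 q1 i j d * z powi wrap2 q1 q2 i j d)"
    by (simp add: nbr_offsets_def off)
  finally show ?thesis
    unfolding hops_def using diag
    by (subst sum.insert) (auto simp: nbr_offsets_def hop_weight_def wrap1_def wrap2_def)
qed

text \<open>In the Leibniz expansion each entry is expanded over \<open>hops\<close>, so a term is a
  permutation together with one hop per site. Along a permutation the site coordinates cancel: the
  exponents, multiplied by the periods, are the total displacement of \<open>q1 * q2\<close> hops of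
  length at most 1, which gives the diamond. At a vertex all hops must be the same unit step, and a
  single term of coefficient 1 or -1 remains.\<close>

lemma det_floquet_laurent:
  assumes q: "q1 > 0" "q2 > 0" and cop: "coprime q1 q2"
  obtains p where "newton_diamond q1 q2 p"
    and "\<And>k. poly (char_poly (floquet_matrix q1 q2 V k)) \<mu> = laurent2 q1 q2 p
          (exp (2 * of_real pi * \<i> * of_real (fst k))) (exp (2 * of_real pi * \<i> * of_real (snd k)))"
proof -
  define N where "N = q1 * q2"
  define T where "T = {f. f permutes {0..<N}} \<times> ({0..<N} \<rightarrow>\<^sub>E hops)"
  define c where "c t = signof (fst t) * (\<Prod>i\<in>{0..<N}. hop_weight q1 q2 V \<mu> i (fst t i) (snd t i))" for t
  define A where "A t = (\<Sum>i\<in>{0..<N}. wrap1 q1 i (fst t i) (snd t i))" for t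
  define B where "B t = (\<Sum>i\<in>{0..<N}. wrap2 q1 q2 i (fst t i) (snd t i))" for t
  define p where "p a b = (\<Sum>t\<in>T. if (A t, B t) = (a, b) then c t else 0)" for a b
  have finh: "finite hops" by (simp add: hops_def)
  have finT: "finite T" unfolding T_def
    using finh by (intro finite_cartesian_product finite_permutations finite_PiE) auto
  have hop_norm: "\<bar>fst d\<bar> + \<bar>snd d\<bar> \<le> 1" if "d \<in> hops" for d
    using that by (auto simp: hops_def nbr_offsets_def)
  have wr: "wraps q1 q2 i (fst t i) (snd t i)" if "c t \<noteq> 0" "i \<in> {0..<N}" for t i
    using that by (auto simp: c_def hop_weight_def split: if_splits)
  have winding: "int q1 * A t = (\<Sum>i\<in>{0..<N}. fst (snd t i))"
    "int q2 * B t = (\<Sum>i\<in>{0..<N}. snd (snd t i))" if t: "t \<in> T" "c t \<noteq> 0" for t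
  proof -
    have f: "fst t permutes {0..<N}" using t(1) by (auto simp: T_def)
    have "int q1 * A t = (\<Sum>i\<in>{0..<N}. fst (site q1 i) + fst (snd t i) - fst (site q1 (fst t i)))"
      unfolding A_def sum_distrib_left using wr[OF t(2)] by (intro sum.cong refl wraps_mult) auto
    then show "int q1 * A t = (\<Sum>i\<in>{0..<N}. fst (snd t i))"
      using sum.permute[OF f, of "\<lambda>i. fst (site q1 i)"]
      by (simp add: sum.distrib sum_subtractf o_def)
    have "int q2 * B t = (\<Sum>i\<in>{0..<N}. snd (site q1 i) + snd (snd t i) - snd (site q1 (fst t i)))"
      unfolding B_def sum_distrib_left using wr[OF t(2)] by (intro sum.cong refl wraps_mult) auto
    then show "int q2 * B t = (\<Sum>i\<in>{0..<N}. snd (snd t i))"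
      using sum.permute[OF f, of "\<lambda>i. snd (site q1 i)"]
      by (simp add: sum.distrib sum_subtractf o_def)
  qed
  have diamond: "int q1 * \<bar>A t\<bar> + int q2 * \<bar>B t\<bar> \<le> int (q1 * q2)" if t: "t \<in> T" "c t \<noteq> 0" for t
  proof -
    have "int q1 * \<bar>A t\<bar> + int q2 * \<bar>B t\<bar> = \<bar>int q1 * A t\<bar> + \<bar>int q2 * B t\<bar>"
      by (simp add: abs_mult)
    also have "\<dots> \<le> (\<Sum>i\<in>{0..<N}. \<bar>fst (snd t i)\<bar>) + (\<Sum>i\<in>{0..<N}. \<bar>snd (snd t i)\<bar>)"
      unfolding winding[OF t] by (intro add_mono sum_abs)
    also have "\<dots> \<le> (\<Sum>i\<in>{0..<N}. 1)"
      unfolding sum.distrib[symmetric] using t(1) by (intro sum_mono hop_norm) (auto simp: T_def)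
    finally show ?thesis by (simp add: N_def)
  qed
  have supp: "int q1 * \<bar>a\<bar> + int q2 * \<bar>b\<bar> \<le> int (q1 * q2)" if nz: "p a b \<noteq> 0" for a b
  proof -
    obtain t where "t \<in> T" "(if (A t, B t) = (a, b) then c t else 0) \<noteq> 0"
      using nz unfolding p_def by (rule sum.not_neutral_contains_not_neutral)
    then show ?thesis using diamond[of t] by (auto split: if_splits)
  qed
  have vertex: "p (int q2 * fst d) (int q1 * snd d) \<noteq> 0"
    if d: "d \<in> set nbr_offsets" for d
  proof -
    define s where "s i = (if i < q1 * q2 then shift_index q1 q2 d i else i)" for i
    define t0 where "t0 = (s, \<lambda>i\<in>{0..<N}. d)"
    have s: "s permutes {0..<N}" 
      unfolding s_def[abs_def] N_def by (rule shift_index_permutes[OF q])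
    have t0: "t0 \<in> T" using s d by (auto simp: t0_def T_def hops_def)
    have d0: "d \<noteq> (0, 0)" using d by (auto simp: nbr_offsets_def)
    have "hop_weight q1 q2 V \<mu> i (fst t0 i) (snd t0 i) = - 1" if "i \<in> {0..<N}" for i
    proof -
      have "wraps q1 q2 i (s i) d"
        using wraps_iff_shift_index[OF q, where d = d]
          shift_index_lt[OF q, where d = d] that by (simp add: s_def N_def)
      then show ?thesis using that d0 by (simp add: t0_def hop_weight_def)
    qed
    then have "c t0 = signof s * (- 1) ^ N" by (simp add: c_def t0_def)
    then have c0: "c t0 \<noteq> 0" by (cases s rule: sign_cases) simp_all
    have "int q1 * A t0 = int q1 * (int q2 * fst d)" "int q2 * B t0 = int q2 * (int q1 * snd d)"
      unfolding winding[OF t0 c0] by (simp_all add: t0_def N_def)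
    then have AB0: "A t0 = int q2 * fst d" "B t0 = int q1 * snd d" using q by simp_all
    have uniq: "t = t0" if t: "t \<in> T" "c t \<noteq> 0" "A t = int q2 * fst d" "B t = int q1 * snd d" for t
    proof -
      \<comment> \<open>The defect of a hop against the direction d. It is nonnegative for every hop
        and its total at the vertex is 0, so every hop equals d.\<close>
      define e where "e i = 1 - (fst d * fst (snd t i) + snd d * snd (snd t i))" for i
      have hop: "snd t i \<in> hops" if "i \<in> {0..<N}" for i using t(1) that by (auto simp: T_def)
      have e0: "e i \<ge> 0" if "i \<in> {0..<N}" for i
        using hop[OF that] d by (auto simp: e_def hops_def nbr_offsets_def)
      have "(\<Sum>i\<in>{0..<N}. e i) =
          int N - (fst d * (\<Sum>i\<in>{0..<N}. fst (snd t i)) + snd d * (\<Sum>i\<in>{0..<N}. snd (snd t i)))"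
        by (simp add: e_def sum_subtractf sum.distrib sum_distrib_left)
      also have "\<dots> = int N - int N * (fst d * fst d + snd d * snd d)"
        unfolding winding[OF t(1,2), symmetric] t(3,4) by (simp add: N_def algebra_simps)
      also have "\<dots> = 0" using d by (auto simp: nbr_offsets_def)
      finally have "\<forall>i\<in>{0..<N}. e i = 0" using e0 by (subst (asm) sum_nonneg_eq_0_iff) auto
      then have "e i = 0" if "i \<in> {0..<N}" for i using that by blast
      then have sd: "snd t i = d" if "i \<in> {0..<N}" for i
        using hop[OF that] d that by (fastforce simp: e_def hops_def nbr_offsets_def)
      have f: "fst t permutes {0..<N}" using t(1) by (auto simp: T_def)
      have "fst t i = s i" for i
      proof (cases "i < N")
        case True
        have "wraps q1 q2 i (fst t i) d" using wr[OF t(2), of i] sd[of i] True by simp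
        moreover have "fst t i < q1 * q2" using permutes_in_image[OF f, of i] True by (simp add: N_def)
        ultimately show ?thesis using wraps_iff_shift_index[OF q, where d = d] True by (simp add: s_def N_def)
      next
        case False
        then show ?thesis using permutes_not_in[OF f, of i] by (simp add: s_def N_def)
      qed
      then have "fst t = s" by blast
      moreover have "snd t = (\<lambda>i\<in>{0..<N}. d)"
        using t(1) sd by (intro extensionalityI[of _ "{0..<N}"]) (auto simp: T_def PiE_def)
      ultimately show ?thesis by (simp add: t0_def prod_eq_iff)
    qed
    have "p (int q2 * fst d) (int q1 * snd d) = (\<Sum>t\<in>T. if t = t0 then c t else 0)"
      unfolding p_def using uniq AB0 by (intro sum.cong) auto
    also have "\<dots> = c t0" using t0 finT by (simp add: sum.delta)
    finally show ?thesis using c0 by simp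
  qed
  have "newton_diamond q1 q2 p"
  proof
    show "p (int q2) 0 \<noteq> 0" using vertex[of "(1, 0)"] by (simp add: nbr_offsets_def)
    show "p (- int q2) 0 \<noteq> 0" using vertex[of "(-1, 0)"] by (simp add: nbr_offsets_def)
    show "p 0 (int q1) \<noteq> 0" using vertex[of "(0, 1)"] by (simp add: nbr_offsets_def)
  qed (use q cop supp in auto)
  moreover have "poly (char_poly (floquet_matrix q1 q2 V k)) \<mu> = laurent2 q1 q2 p
      (exp (2 * of_real pi * \<i> * of_real (fst k))) (exp (2 * of_real pi * \<i> * of_real (snd k)))" for k
  proof -
    define x where "x = exp (2 * of_real pi * \<i> * of_real (fst k) :: complex)"
    define z where "z = exp (2 * of_real pi * \<i> * of_real (snd k) :: complex)"
    define D where "D = floquet_matrix q1 q2 V k"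
    define M where "M = mat N N (\<lambda>(i, j). (if i = j then \<mu> else 0) - D $$ (i, j))"
    have Dc: "D \<in> carrier_mat N N" by (simp add: D_def floquet_matrix_def N_def)
    have Mc: "M \<in> carrier_mat N N" by (simp add: M_def)
    have x0: "x \<noteq> 0" and z0: "z \<noteq> 0" by (simp_all add: x_def z_def)
    define w where "w i j d = hop_weight q1 q2 V \<mu> i j d * x powi wrap1 q1 i j d * z powi wrap2 q1 q2 i j d"
      for i j d
    have "poly (char_poly D) \<mu> = det M"
      unfolding char_poly_def
      by (rule poly_det_cong[OF Mc]) (use Dc in \<open>auto simp: M_def char_poly_matrix_def\<close>)
    also have "\<dots> = (\<Sum>f\<in>{f. f permutes {0..<N}}. signof f * (\<Prod>i\<in>{0..<N}. \<Sum>d\<in>hops. w i (f i) d))"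
      unfolding det_def'[OF Mc]
    proof (rule sum.cong[OF refl])
      fix f assume "f \<in> {f. f permutes {0..<N}}"
      then have "i < N \<Longrightarrow> f i < N" for i using permutes_in_image[of f "{0..<N}" i] by simp
      then show "signof f * (\<Prod>i = 0..<N. M $$ (i, f i)) =
          signof f * (\<Prod>i\<in>{0..<N}. \<Sum>d\<in>hops. w i (f i) d)"
        using floquet_entry_hops[OF q, of _ _ \<mu> V k]
        by (intro arg_cong2[where f = times] prod.cong refl)
          (simp add: M_def D_def N_def w_def x_def z_def)
    qed
    also have "\<dots> = (\<Sum>t\<in>T. signof (fst t) * (\<Prod>i\<in>{0..<N}. w i (fst t i) (snd t i)))"
      unfolding T_def sum.cartesian_product'
      using finh by (simp add: prod_sum_PiE sum_distrib_left case_prod_beta sum.cartesian_product)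
    also have "\<dots> = (\<Sum>t\<in>T. c t * x powi A t * z powi B t)"
      using x0 z0 by (simp add: w_def c_def A_def B_def prod.distrib prod_power_int mult.assoc)
    also have "\<dots> = laurent2 q1 q2 p x z"
      unfolding p_def
    proof (rule laurent2_sum_monomials[symmetric, OF finT])
      fix t assume "t \<in> T" "c t \<noteq> 0"
      then have le: "int q1 * \<bar>A t\<bar> + int q2 * \<bar>B t\<bar> \<le> int q1 * int q2" using diamond by simp
      then have "int q1 * \<bar>A t\<bar> \<le> int q1 * int q2" "int q2 * \<bar>B t\<bar> \<le> int q2 * int q1"
        using mult_nonneg_nonneg[of "int q1" "\<bar>A t\<bar>"] mult_nonneg_nonneg[of "int q2" "\<bar>B t\<bar>"]
        by (simp_all only: mult.commute[of "int q2" "int q1"]) linarith+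
      then show "\<bar>A t\<bar> \<le> int q2 \<and> \<bar>B t\<bar> \<le> int q1" using q by (simp add: mult_le_cancel_left)
    qed
    finally show ?thesis by (simp add: D_def x_def z_def)
  qed
  ultimately show ?thesis using that by blast
qed

section \<open>Critical points of eigenvalues of Hermitian matrices\<close>

definition hermitian_mat :: "complex mat \<Rightarrow> bool" where
  "hermitian_mat A \<longleftrightarrow> (\<forall>i<dim_row A. \<forall>j<dim_row A. A $$ (i, j) = cnj (A $$ (j, i)))"

lemma hermitian_matD:
  assumes "hermitian_mat A" "A \<in> carrier_mat n n" "i < n" "j < n"
  shows "A $$ (i, j) = cnj (A $$ (j, i))"
  using assms unfolding hermitian_mat_def carrier_mat_def by blast

lemma mult_mat_vec_sum:
  assumes "A \<in> carrier_mat n n" "v \<in> carrier_vec n" "i < n"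
  shows "(A *\<^sub>v v) $ i = (\<Sum>j<n. A $$ (i, j) * v $ j)"
  using assms by (auto simp: scalar_prod_def atLeast0LessThan intro!: sum.cong)

lemma hermitian_form_swap:
  assumes A: "A \<in> carrier_mat n n" "hermitian_mat A"
    and v: "v \<in> carrier_vec n" and w: "w \<in> carrier_vec n"
  shows "(\<Sum>i<n. (A *\<^sub>v v) $ i * cnj (w $ i)) = (\<Sum>j<n. v $ j * cnj ((A *\<^sub>v w) $ j))"
proof -
  have "(\<Sum>i<n. (A *\<^sub>v v) $ i * cnj (w $ i)) = (\<Sum>i<n. \<Sum>j<n. A $$ (i, j) * v $ j * cnj (w $ i))"
    using mult_mat_vec_sum[OF A(1) v] by (simp add: sum_distrib_right)
  also have "\<dots> = (\<Sum>j<n. \<Sum>i<n. A $$ (i, j) * v $ j * cnj (w $ i))" by (rule sum.swap)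
  also have "\<dots> = (\<Sum>j<n. \<Sum>i<n. v $ j * (cnj (A $$ (j, i)) * cnj (w $ i)))"
  proof (intro sum.cong refl)
    fix i j assume "i \<in> {..<n}" "j \<in> {..<n}"
    then have "A $$ (i, j) = cnj (A $$ (j, i))"
      using hermitian_matD[OF A(2,1)] by blast
    then show "A $$ (i, j) * v $ j * cnj (w $ i) = v $ j * (cnj (A $$ (j, i)) * cnj (w $ i))"
      by simp
  qed
  also have "\<dots> = (\<Sum>j<n. v $ j * cnj ((A *\<^sub>v w) $ j))"
    using mult_mat_vec_sum[OF A(1) w] by (simp add: sum_distrib_left cnj_sum)
  finally show ?thesis .
qed

lemma sum_mult_cnj_eq_0:
  fixes v :: "complex vec"
  assumes "v \<in> carrier_vec n" "(\<Sum>i<n. v $ i * cnj (v $ i)) = 0"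
  shows "v = 0\<^sub>v n"
proof -
  have "(\<Sum>i<n. v $ i * cnj (v $ i)) = of_real (\<Sum>i<n. (norm (v $ i))\<^sup>2)"
    by (simp only: complex_norm_square of_real_sum)
  then have "(\<Sum>i<n. (norm (v $ i))\<^sup>2) = 0"
    using assms(2) by (metis of_real_eq_0_iff)
  then have "\<forall>i<n. v $ i = 0" by (subst (asm) sum_nonneg_eq_0_iff) auto
  then show ?thesis using assms(1) by auto
qed

text \<open>The squared norm of A v is the pairing of v with A (A v). This is what rules out Jordan
  blocks.\<close>

lemma hermitian_square_kernel:
  assumes A: "A \<in> carrier_mat n n" "hermitian_mat A" and v: "v \<in> carrier_vec n"
    and 0: "A *\<^sub>v (A *\<^sub>v v) = 0\<^sub>v n"
  shows "A *\<^sub>v v = 0\<^sub>v n"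
proof -
  have w: "A *\<^sub>v v \<in> carrier_vec n" using A(1) v by auto
  have "(\<Sum>i<n. (A *\<^sub>v v) $ i * cnj ((A *\<^sub>v v) $ i)) = 0"
    unfolding hermitian_form_swap[OF A v w] 0 by simp
  then show ?thesis by (rule sum_mult_cnj_eq_0[OF w])
qed

lemma hermitian_eigenvalue_real:
  assumes A: "A \<in> carrier_mat n n" "hermitian_mat A"
    and root: "poly (char_poly A) \<mu> = 0"
  shows "\<mu> = of_real (Re \<mu>)"
proof -
  obtain v where v: "v \<in> carrier_vec n" "v \<noteq> 0\<^sub>v n" and Av: "A *\<^sub>v v = \<mu> \<cdot>\<^sub>v v"
    using root eigenvalue_root_char_poly[OF A(1)] A(1)
    by (auto simp: eigenvalue_def eigenvector_def)
  define s where "s = (\<Sum>i<n. v $ i * cnj (v $ i))"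
  have "(\<Sum>i<n. (A *\<^sub>v v) $ i * cnj (v $ i)) = \<mu> * s"
    unfolding Av s_def sum_distrib_left using v(1) by (intro sum.cong) auto
  moreover have "(\<Sum>i<n. v $ i * cnj ((A *\<^sub>v v) $ i)) = cnj \<mu> * s"
    unfolding Av s_def sum_distrib_left using v(1) by (intro sum.cong) auto
  ultimately have "\<mu> * s = cnj \<mu> * s" using hermitian_form_swap[OF A v(1) v(1)] by (simp only:)
  moreover have "s \<noteq> 0" using sum_mult_cnj_eq_0[OF v(1)] v(2) by (auto simp: s_def)
  ultimately have "cnj \<mu> = \<mu>" by simp
  then show ?thesis by (simp add: complex_eq_iff)
qed

lemma char_poly_eq_prod_proots:
  fixes A :: "complex mat"
  assumes "A \<in> carrier_mat n n"
  shows "char_poly A = (\<Prod>x\<in>#proots (char_poly A). [:- x, 1:])"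
    and "size (proots (char_poly A)) = n"
proof -
  have m: "degree (char_poly A) = n" "monic (char_poly A)"
    using degree_monic_char_poly[OF assms] by auto
  show "char_poly A = (\<Prod>x\<in>#proots (char_poly A). [:- x, 1:])"
    using complex_poly_decompose_multiset[of "char_poly A"] m by simp
  show "size (proots (char_poly A)) = n" using m size_proots_complex by simp
qed

text \<open>A Hermitian matrix has no Jordan blocks, so a double eigenvalue comes with two
  independent eigenvectors; Schur's decomposition puts them into the first two columns of \<open>P\<close>.\<close>

lemma hermitian_double_eigenvalue:
  fixes A :: "complex mat" and \<mu> :: real
  assumes A: "A \<in> carrier_mat n n" "hermitian_mat A"
    and mult: "2 \<le> count (proots (char_poly A)) (of_real \<mu>)"
  obtains P Q where "P \<in> carrier_mat n n" "Q \<in> carrier_mat n n" "Q * P = 1\<^sub>m n" "2 \<le> n"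
    and "\<And>i j. i < n \<Longrightarrow> j < 2 \<Longrightarrow>
           (Q * (of_real \<mu> \<cdot>\<^sub>m 1\<^sub>m n - A) * P) $$ (i, j) = 0"
proof -
  define l where "l = complex_of_real \<mu>"
  define C where "C = l \<cdot>\<^sub>m 1\<^sub>m n - A"
  have Cc: "C \<in> carrier_mat n n" using minus_carrier_mat[OF A(1)] by (simp add: C_def)
  have Ch: "hermitian_mat C"
    unfolding hermitian_mat_def
  proof (intro allI impI)
    fix i j assume "i < dim_row C" "j < dim_row C"
    then have ij: "i < n" "j < n" using Cc by auto
    have "C $$ (i, j) = (if i = j then l else 0) - A $$ (i, j)"
      "C $$ (j, i) = (if i = j then l else 0) - A $$ (j, i)"
      using ij A(1) by (simp_all add: C_def)
    then show "C $$ (i, j) = cnj (C $$ (j, i))"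
      using hermitian_matD[OF A(2,1) ij] by (simp add: l_def)
  qed
  define M where "M = proots (char_poly A) - {#l, l#}"
  have "{#l, l#} \<subseteq># proots (char_poly A)"
    using mult by (auto simp: l_def subseteq_mset_def)
  then have M: "proots (char_poly A) = {#l, l#} + M"
    unfolding M_def by (rule subset_mset.add_diff_inverse[symmetric])
  \<comment> \<open>The Schur decomposition keeps the order of the eigenvalue list it is given, so l
    is listed twice in front to occupy the first two diagonal places.\<close>
  obtain es where es: "mset es = M" using ex_mset by blast
  have "char_poly A = (\<Prod>x\<in>#mset (l # l # es). [:- x, 1:])"
    using char_poly_eq_prod_proots(1)[OF A(1)] M es by simp
  then have cp: "char_poly A = (\<Prod>e\<leftarrow>l # l # es. [:- e, 1:])"
    by (simp only: prod_mset_prod_list[symmetric] mset_map)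
  have n2: "2 \<le> n" using char_poly_eq_prod_proots(2)[OF A(1)] M by simp
  obtain B P Q where BPQ: "schur_decomposition A (l # l # es) = (B, P, Q)"
    by (cases "schur_decomposition A (l # l # es)") auto
  from schur_decomposition[OF A(1) cp BPQ]
  have sim: "similar_mat_wit A B P Q" and ut: "upper_triangular B" and diag: "diag_mat B = l # l # es"
    by auto
  note w = similar_mat_witD2[OF A(1) sim]
  have B00: "B $$ (0, 0) = l" "B $$ (1, 1) = l"
    using arg_cong[OF diag, of "\<lambda>xs. xs ! 0"] arg_cong[OF diag, of "\<lambda>xs. xs ! 1"] w(5) n2
    by (auto simp: diag_mat_def)
  have Bz: "B $$ (i, j) = 0" if "j < i" "i < n" for i j
    using ut that w(5) by (auto simp: upper_triangular_def)
  have AP: "A * P = P * B"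
  proof -
    have "A * P = P * B * (Q * P)" unfolding w(3) using w(4-7)
      by (simp add: assoc_mult_mat[of _ n n _ n _ n])
    then show ?thesis using w(2,5,6) by simp
  qed
  have CP: "C * P = P * (l \<cdot>\<^sub>m 1\<^sub>m n - B)"
  proof -
    have "l \<cdot>\<^sub>m 1\<^sub>m n * P = l \<cdot>\<^sub>m P"
      using mult_smult_assoc_mat[OF one_carrier_mat w(6)] w(6) by simp
    then have "C * P = l \<cdot>\<^sub>m P - A * P"
      unfolding C_def using A(1) w(6) by (simp add: minus_mult_distrib_mat[of _ n n])
    also have "P * (l \<cdot>\<^sub>m 1\<^sub>m n) = l \<cdot>\<^sub>m P"
      using mult_smult_distrib[OF w(6) one_carrier_mat] w(6) by simp
    then have "l \<cdot>\<^sub>m P - A * P = P * (l \<cdot>\<^sub>m 1\<^sub>m n - B)"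
      unfolding AP using w(5,6) by (simp add: mult_minus_distrib_mat[of _ n n _ n])
    finally show ?thesis .
  qed
  have CP_entry: "(C * P) $$ (i, j) = (\<Sum>k<n. P $$ (i, k) * ((if k = j then l else 0) - B $$ (k, j)))"
    if "i < n" "j < n" for i j
    unfolding CP using that w(5,6)
    by (auto simp: scalar_prod_def atLeast0LessThan intro!: sum.cong)
  have Ccol: "C *\<^sub>v col P j = col (C * P) j" if "j < n" for j
    using that Cc w(6) by (metis col_mult2)
  have col0: "col (C * P) 0 = 0\<^sub>v n"
  proof (rule eq_vecI)
    fix i assume i: "i < dim_vec (0\<^sub>v n :: complex vec)"
    then have "(C * P) $$ (i, 0) = 0" using n2 B00 Bz
      by (subst CP_entry) (auto intro!: sum.neutral)
    then show "col (C * P) 0 $ i = 0\<^sub>v n $ i" using i n2 Cc w(6) by simp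
  qed (use Cc in simp)
  \<comment> \<open>By triangularity only the entry above the second l survives: C sends the second
    column of P to a multiple of the first, and C kills the first. So C squared kills the second
    column, hence so does C.\<close>
  have col1: "col (C * P) 1 = (- B $$ (0, 1)) \<cdot>\<^sub>v col P 0"
  proof (rule eq_vecI)
    fix i assume "i < dim_vec ((- B $$ (0, 1)) \<cdot>\<^sub>v col P 0)"
    then have i: "i < n" using w(6) by simp
    have "(C * P) $$ (i, 1) = (\<Sum>k<n. if k = 0 then P $$ (i, 0) * (- B $$ (0, 1)) else 0)"
      unfolding CP_entry[OF i n2[unfolded numeral_2_eq_2 Suc_le_eq, folded One_nat_def]]
    proof (rule sum.cong[OF refl])
      fix k assume k: "k \<in> {..<n}"
      consider "k = 0" | "k = 1" | "1 < k" by linarith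
      then show "P $$ (i, k) * ((if k = 1 then l else 0) - B $$ (k, 1)) =
          (if k = 0 then P $$ (i, 0) * (- B $$ (0, 1)) else 0)"
        by cases (use B00 Bz[of 1 k] k in auto)
    qed
    then have "(C * P) $$ (i, 1) = P $$ (i, 0) * (- B $$ (0, 1))" using n2 by (simp add: sum.delta)
    then show "col (C * P) 1 $ i = ((- B $$ (0, 1)) \<cdot>\<^sub>v col P 0) $ i"
      using i n2 Cc w(6) by (simp add: mult.commute)
  qed (use Cc w(6) in simp)
  have colP: "col P j \<in> carrier_vec n" for j 
    by (rule carrier_vecI) (use w(6) in simp)
  have "C *\<^sub>v (C *\<^sub>v col P 1) = (- B $$ (0, 1)) \<cdot>\<^sub>v (C *\<^sub>v col P 0)"
    using n2 Ccol[of 1] col1 mult_mat_vec[OF Cc colP[of 0]] by simp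
  also have "C *\<^sub>v col P 0 = 0\<^sub>v n" using n2 Ccol[of 0] col0 by simp
  also have "(- B $$ (0, 1)) \<cdot>\<^sub>v 0\<^sub>v n = 0\<^sub>v n" by (intro eq_vecI) simp_all
  finally have "C *\<^sub>v col P 1 = 0\<^sub>v n" by (rule hermitian_square_kernel[OF Cc Ch colP])
  then have col1': "col (C * P) 1 = 0\<^sub>v n" using n2 Ccol[of 1] by simp
  have zero: "(C * P) $$ (k, j) = 0" if "k < n" "j < 2" for k j
  proof -
    have "j = 0 \<or> j = 1" using that by auto
    then have "col (C * P) j $ k = 0" using col0 col1' that by auto
    then show ?thesis using that n2 Cc w(6) by simp
  qed
  have "(Q * C * P) $$ (i, j) = 0" if "i < n" "j < 2" for i j
  proof -
    have "Q * C * P = Q * (C * P)" using w(6,7) Cc by simp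
    also have "(Q * (C * P)) $$ (i, j) = (\<Sum>k<n. Q $$ (i, k) * (C * P) $$ (k, j))"
      using that n2 w(6,7) Cc
      by (auto simp: scalar_prod_def[of "row Q i"] atLeast0LessThan intro!: sum.cong)
    also have "\<dots> = 0" using zero that by (auto intro!: sum.neutral)
    finally show ?thesis .
  qed
  then show ?thesis using that[OF w(6,7,2) n2] by (simp add: C_def l_def)
qed

subsection \<open>Derivatives of determinants\<close>

lemma det_has_derivative:
  fixes M :: "real \<Rightarrow> complex mat"
  assumes M: "\<And>t. M t \<in> carrier_mat n n"
    and d: "\<And>i j. i < n \<Longrightarrow> j < n \<Longrightarrow> ((\<lambda>t. M t $$ (i, j)) has_derivative M' i j) (at t0)"
  shows "((\<lambda>t. det (M t)) has_derivative
    (\<lambda>h. \<Sum>f | f permutes {0..<n}. signof f *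
        (\<Sum>i\<in>{0..<n}. M' i (f i) h * (\<Prod>j\<in>{0..<n} - {i}. M t0 $$ (j, f j))))) (at t0)"
  unfolding det_def'[OF M]
proof (intro has_derivative_sum has_derivative_mult_right has_derivative_prod)
  fix f i assume "f \<in> {f. f permutes {0..<n}}" "i \<in> {0..<n}"
  then show "((\<lambda>t. M t $$ (i, f i)) has_derivative M' i (f i)) (at t0)"
    using permutes_in_image[of f "{0..<n}" i] by (intro d) auto
qed

lemma det_differentiable:
  fixes M :: "real \<Rightarrow> complex mat"
  assumes M: "\<And>t. M t \<in> carrier_mat n n"
    and d: "\<And>i j. i < n \<Longrightarrow> j < n \<Longrightarrow> (\<lambda>t. M t $$ (i, j)) differentiable (at t0)"
  shows "(\<lambda>t. det (M t)) differentiable (at t0)"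
proof -
  obtain M' where "\<And>i j. i < n \<Longrightarrow> j < n \<Longrightarrow> ((\<lambda>t. M t $$ (i, j)) has_derivative M' i j) (at t0)"
    using d unfolding differentiable_def by metis
  from det_has_derivative[OF M this] show ?thesis unfolding differentiable_def by blast
qed

text \<open>Each summand of the derivative omits one factor of a Leibniz product, but a permutation
  meets the two zero columns in different rows, so a zero factor remains.\<close>

lemma det_two_zero_columns_derivative:
  fixes M :: "real \<Rightarrow> complex mat"
  assumes M: "\<And>t. M t \<in> carrier_mat n n" and n: "2 \<le> n"
    and d: "\<And>i j. i < n \<Longrightarrow> j < n \<Longrightarrow> (\<lambda>t. M t $$ (i, j)) differentiable (at t0)"
    and z: "\<And>i j. i < n \<Longrightarrow> j < 2 \<Longrightarrow> M t0 $$ (i, j) = 0"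
  shows "((\<lambda>t. det (M t)) has_derivative (\<lambda>h. 0)) (at t0)"
proof -
  obtain M' where M': "\<And>i j. i < n \<Longrightarrow> j < n \<Longrightarrow> ((\<lambda>t. M t $$ (i, j)) has_derivative M' i j) (at t0)"
    using d unfolding differentiable_def by metis
  have "(\<Prod>j\<in>{0..<n} - {i}. M t0 $$ (j, f j)) = 0" if f: "f permutes {0..<n}" for f i
  proof -
    have "f (inv_into UNIV f 0) = 0" "f (inv_into UNIV f 1) = 1" using permutes_inverses(1)[OF f] by simp_all
    then have "\<exists>j. j \<noteq> i \<and> f j < 2" 
      by (cases "inv_into UNIV f 0 = i") (metis one_less_numeral_iff semiring_norm(76) zero_neq_one, force)
    then obtain j where j: "j \<noteq> i" "f j < 2" by blast
    then have "j < n" using permutes_in_image[OF f, of j] n by simp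
    then have "M t0 $$ (j, f j) = 0" using z j by simp
    then show ?thesis using j \<open>j < n\<close> by (intro prod_zero) auto
  qed
  then show ?thesis using det_has_derivative[OF M M'] by simp
qed

subsection \<open>Continuity of ordered real roots\<close>

text \<open>Bolzano-Weierstrass in N coordinates, passing to a monotone subsequence for one
  coordinate at a time.\<close>

lemma bounded_coordinates_subseq:
  fixes x :: "nat \<Rightarrow> nat \<Rightarrow> real"
  assumes "\<And>j. j < N \<Longrightarrow> Bseq (\<lambda>n. x n j)"
  shows "\<exists>r l. strict_mono r \<and> (\<forall>j<N. (\<lambda>n. x (r n) j) \<longlonglongrightarrow> l j)"
  using assms
proof (induction N)
  case 0
  then show ?case by (intro exI[of _ id]) (auto simp: strict_mono_def)
next
  case (Suc N)
  then obtain r l where r: "strict_mono r" and l: "\<And>j. j < N \<Longrightarrow> (\<lambda>n. x (r n) j) \<longlonglongrightarrow> l j"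
    by (meson less_SucI)
  obtain s :: "nat \<Rightarrow> nat" where s: "strict_mono s" "monoseq (\<lambda>n. x (r (s n)) N)"
    using seq_monosub[of "\<lambda>n. x (r n) N"] by blast
  have "Bseq (\<lambda>n. x (r (s n)) N)"
    using Bseq_subseq[of "\<lambda>n. x n N" "r \<circ> s"] Suc.prems[of N] by (simp add: o_def)
  then obtain a where a: "(\<lambda>n. x (r (s n)) N) \<longlonglongrightarrow> a"
    using Bseq_monoseq_convergent[OF _ s(2)] by (auto simp: convergent_def)
  have "(\<lambda>n. x ((r \<circ> s) n) j) \<longlonglongrightarrow> (l(N := a)) j" if "j < Suc N" for j
  proof (cases "j = N")
    case True
    then show ?thesis using a by simp
  next
    case False
    then have "(\<lambda>n. x (r n) j) \<longlonglongrightarrow> l j" using that l by simp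
    from LIMSEQ_subseq_LIMSEQ[OF this s(1)] show ?thesis using False by (simp add: o_def)
  qed
  moreover have "strict_mono (r \<circ> s)" using r s(1) by (rule strict_mono_o)
  ultimately show ?case by blast
qed

lemma sorted_roots_unique:
  fixes xs ys :: "real list"
  assumes "sorted xs" "sorted ys" "length xs = N" "length ys = N"
    and eq: "\<And>z :: complex. (\<Prod>j<N. z - of_real (xs ! j)) = (\<Prod>j<N. z - of_real (ys ! j))"
  shows "xs = ys"
proof -
  define F where "F zs = (\<Prod>x\<leftarrow>zs. [:- complex_of_real x, 1:])" for zs
  have polyF: "poly (F zs) z = (\<Prod>j<length zs. z - of_real (zs ! j))" for zs z
    by (simp add: F_def prod.list_conv_set_nth atLeast0LessThan poly_prod)
  have FCons: "F (x # zs) = [:- complex_of_real x, 1:] * F zs" for x zs by (simp add: F_def)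
  have nz: "F zs \<noteq> 0" for zs
  proof (induction zs)
    case (Cons x zs)
    then show ?case unfolding FCons by (metis mult_eq_0_iff pCons_eq_0_iff one_neq_zero)
  qed (simp add: F_def)
  have roots: "proots (F zs) = image_mset of_real (mset zs)" for zs
  proof (induction zs)
    case (Cons x zs)
    then show ?case unfolding FCons by (subst proots_mult) (use nz in simp_all)
  qed (simp add: F_def)
  have "F xs = F ys" using eq assms(3,4) by (simp add: poly_eq_poly_eq_iff[symmetric] fun_eq_iff polyF)
  then have "image_mset complex_of_real (mset xs) = image_mset of_real (mset ys)"
    using roots by metis
  then have "image_mset Re (image_mset complex_of_real (mset xs)) =
      image_mset Re (image_mset complex_of_real (mset ys))" by simp
  then have "mset xs = mset ys" by (simp add: image_mset.compositionality o_def)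
  then show ?thesis using assms(1,2) by (metis properties_for_sort)
qed

text \<open>Evaluating at \<open>\<i>\<close> bounds all roots, since \<open>\<bar>\<i> - r\<bar>\<^sup>2 = 1 + r\<^sup>2\<close> for real \<open>r\<close>; a
  convergent subsequence of the ordered roots then has the right limit by unique factorization.\<close>

lemma sorted_roots_continuous:
  fixes L :: "real \<Rightarrow> real list"
  assumes sorted: "\<And>t. sorted (L t)" and len: "\<And>t. length (L t) = N"
    and cont: "\<And>z :: complex. isCont (\<lambda>t. \<Prod>j<N. z - of_real (L t ! j)) t0"
    and j: "j < N"
  shows "isCont (\<lambda>t. L t ! j) t0"
  unfolding isCont_def LIMSEQ_SEQ_conv[symmetric]
proof (intro allI impI, elim conjE)
  fix u :: "nat \<Rightarrow> real" assume u: "u \<longlonglongrightarrow> t0"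
  define f where "f t z = (\<Prod>j<N. z - complex_of_real (L t ! j))" for t z
  have flim: "(\<lambda>n. f (v n) z) \<longlonglongrightarrow> f t0 z" if "v \<longlonglongrightarrow> t0" for v z
    using isCont_tendsto_compose[OF cont that] by (simp add: f_def)
  have bnd: "\<bar>L t ! i\<bar> \<le> norm (f t \<i>)" if "i < N" for t i
  proof -
    have ge: "norm (\<i> - complex_of_real r) \<ge> 1" "norm (\<i> - complex_of_real r) \<ge> \<bar>r\<bar>" for r
      using abs_Im_le_cmod[of "\<i> - complex_of_real r"] abs_Re_le_cmod[of "\<i> - complex_of_real r"]
      by simp_all
    have "norm (\<i> - complex_of_real (L t ! i)) * 1 \<le>
        norm (\<i> - complex_of_real (L t ! i)) * (\<Prod>j\<in>{..<N} - {i}. norm (\<i> - complex_of_real (L t ! j)))"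
      using ge by (intro mult_left_mono prod_ge_1) auto
    also have "\<dots> = norm (f t \<i>)"
      using that by (simp add: f_def prod_norm prod.remove[of "{..<N}" i] norm_mult)
    finally show ?thesis using ge(2)[of "L t ! i"] by linarith
  qed
  show "(\<lambda>n. L (u n) ! j) \<longlonglongrightarrow> L t0 ! j"
  proof (rule ccontr)
    assume "\<not> ?thesis"
    then obtain e where e: "e > 0" and inf: "\<forall>n0. \<exists>n\<ge>n0. dist (L (u n) ! j) (L t0 ! j) \<ge> e"
      unfolding lim_sequentially by (meson not_less)
    have "infinite {n. dist (L (u n) ! j) (L t0 ! j) \<ge> e}"
      unfolding infinite_nat_iff_unbounded_le using inf by blast
    then obtain s :: "nat \<Rightarrow> nat" where s: "strict_mono s"
      and far: "\<And>n. dist (L (u (s n)) ! j) (L t0 ! j) \<ge> e"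
      using infinite_enumerate by (metis (mono_tags, lifting) mem_Collect_eq)
    define v where "v = u \<circ> s"
    have v: "v \<longlonglongrightarrow> t0" unfolding v_def using u s by (rule LIMSEQ_subseq_LIMSEQ)
    have "Bseq (\<lambda>n. f (v n) \<i>)"
      using flim[OF v] by (intro convergent_imp_Bseq) (auto simp: convergent_def)
    then obtain K where K: "\<And>n. norm (f (v n) \<i>) \<le> K" by (auto simp: Bseq_def)
    have "Bseq (\<lambda>n. L (v n) ! i)" if "i < N" for i
    proof (rule BseqI'[of _ K])
      show "norm (L (v n) ! i) \<le> K" for n using bnd[OF that, of "v n"] K[of n] by simp
    qed
    then obtain r l where r: "strict_mono r" and l: "\<And>i. i < N \<Longrightarrow> (\<lambda>n. L (v (r n)) ! i) \<longlonglongrightarrow> l i"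
      using bounded_coordinates_subseq[of N "\<lambda>n i. L (v n) ! i"] by blast
    have vr: "(\<lambda>n. v (r n)) \<longlonglongrightarrow> t0" using LIMSEQ_subseq_LIMSEQ[OF v r] by (simp add: o_def)
    have "map l [0..<N] = L t0"
    proof (rule sorted_roots_unique)
      show "sorted (map l [0..<N])"
        unfolding sorted_iff_nth_mono
      proof (intro allI impI)
        fix a b assume ab: "a \<le> b" "b < length (map l [0..<N])"
        have "l a \<le> l b"
        proof (rule LIMSEQ_le[OF l l])
          show "\<exists>n0. \<forall>n\<ge>n0. L (v (r n)) ! a \<le> L (v (r n)) ! b"
            using ab sorted len by (intro exI allI impI sorted_nth_mono) auto
        qed (use ab in auto)
        then show "map l [0..<N] ! a \<le> map l [0..<N] ! b" using ab by simp
      qed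
      fix z :: complex
      have "(\<lambda>n. f (v (r n)) z) \<longlonglongrightarrow> (\<Prod>j<N. z - of_real (l j))"
        unfolding f_def using l by (intro tendsto_intros) auto
      moreover have "(\<lambda>n. f (v (r n)) z) \<longlonglongrightarrow> f t0 z" by (rule flim[OF vr])
      ultimately have "(\<Prod>j<N. z - of_real (l j)) = f t0 z" by (rule LIMSEQ_unique)
      then show "(\<Prod>j<N. z - of_real (map l [0..<N] ! j)) = (\<Prod>j<N. z - of_real (L t0 ! j))"
        by (simp add: f_def)
    qed (use sorted len in auto)
    then have "l j = L t0 ! j" using j by (metis add_0 length_map length_upt minus_nat.diff_0 nth_map nth_upt)
    then have "(\<lambda>n. dist (L (v (r n)) ! j) (L t0 ! j)) \<longlonglongrightarrow> dist (L t0 ! j) (L t0 ! j)"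
      using l[OF j] by (intro tendsto_dist tendsto_const) simp
    then have "e \<le> dist (L t0 ! j) (L t0 ! j)"
      by (rule LIMSEQ_le_const) (use far in \<open>auto simp: v_def\<close>)
    then show False using e by simp
  qed
qed

subsection \<open>Extrema of ordered eigenvalues\<close>

lemma count_le_count_image_mset: "count M x \<le> count (image_mset f M) (f x)"
  by (induction M) auto

definition ordered_eigenvalues :: "complex mat \<Rightarrow> real list" where
  "ordered_eigenvalues A = sorted_list_of_multiset (image_mset Re (proots (char_poly A)))"

text \<open>Since all roots are real, taking \<open>Re\<close> in the ordered list loses neither
  values nor multiplicities.\<close>

lemma hermitian_proots:
  assumes A: "A \<in> carrier_mat n n" "hermitian_mat A"
  shows "proots (char_poly A) = image_mset complex_of_real (mset (ordered_eigenvalues A))"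
proof -
  have "char_poly A \<noteq> 0" using degree_monic_char_poly[OF A(1)] by auto
  then have "complex_of_real (Re x) = x" if "x \<in># proots (char_poly A)" for x
    using that hermitian_eigenvalue_real[OF A, of x] by simp
  then have "image_mset (\<lambda>x. complex_of_real (Re x)) (proots (char_poly A)) = proots (char_poly A)"
    by (simp cong: image_mset_cong)
  then show ?thesis by (simp add: ordered_eigenvalues_def image_mset.compositionality o_def)
qed

lemma length_ordered_eigenvalues:
  assumes "A \<in> carrier_mat n n"
  shows "length (ordered_eigenvalues A) = n"
proof -
  have "length (ordered_eigenvalues A) = size (mset (ordered_eigenvalues A))" by simp
  also have "\<dots> = n"
    unfolding ordered_eigenvalues_def mset_sorted_list_of_multiset
    using char_poly_eq_prod_proots(2)[OF assms] by simp
  finally show ?thesis .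
qed

lemma poly_char_poly_hermitian:
  assumes A: "A \<in> carrier_mat n n" "hermitian_mat A"
  shows "poly (char_poly A) z = (\<Prod>j<n. z - of_real (ordered_eigenvalues A ! j))"
proof -
  define xs where "xs = ordered_eigenvalues A"
  have "char_poly A = (\<Prod>x\<in>#mset xs. [:- complex_of_real x, 1:])"
    using char_poly_eq_prod_proots(1)[OF A(1)] unfolding hermitian_proots[OF A] xs_def
    by (simp add: image_mset.compositionality o_def)
  also have "\<dots> = (\<Prod>x\<leftarrow>xs. [:- complex_of_real x, 1:])"
    by (simp only: prod_mset_prod_list[symmetric] mset_map)
  also have "\<dots> = (\<Prod>j<n. [:- complex_of_real (xs ! j), 1:])"
    using length_ordered_eigenvalues[OF A(1)]
    by (simp add: prod.list_conv_set_nth atLeast0LessThan xs_def)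
  finally show ?thesis by (simp add: poly_prod xs_def)
qed

lemma mult_mat_entry:
  assumes "A \<in> carrier_mat n n" "B \<in> carrier_mat n n" "i < n" "j < n"
  shows "(A * B) $$ (i, j) = (\<Sum>k<n. A $$ (i, k) * B $$ (k, j))"
  using assms by (auto simp: scalar_prod_def atLeast0LessThan intro!: sum.cong)

lemma poly_char_poly_det:
  assumes "A \<in> carrier_mat n n"
  shows "poly (char_poly A) z = det (z \<cdot>\<^sub>m 1\<^sub>m n - A)"
  unfolding char_poly_def
proof (rule poly_det_cong)
  show "z \<cdot>\<^sub>m 1\<^sub>m n - A \<in> carrier_mat n n" using assms by (rule minus_carrier_mat)
  show "char_poly_matrix A \<in> carrier_mat n n" using assms by simp
qed (use assms in \<open>auto simp: char_poly_matrix_def\<close>)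

text \<open>An ordered eigenvalue may fail to be differentiable at a crossing, but the
  characteristic polynomial at the fixed value \<mu> is differentiable. If \<mu> is a multiple
  eigenvalue at t0, a constant change of basis produces two zero columns at t0. If it is simple, the
  product of the other factors keeps its sign near t0, so the polynomial has a local extremum
  there.\<close>

lemma eigenvalue_extremum_critical:
  fixes A :: "real \<Rightarrow> complex mat"
  assumes A: "\<And>t. A t \<in> carrier_mat n n" "\<And>t. hermitian_mat (A t)"
    and diff: "\<And>i j. i < n \<Longrightarrow> j < n \<Longrightarrow> (\<lambda>t. A t $$ (i, j)) differentiable (at t0)"
    and m: "m < n" and \<mu>: "ordered_eigenvalues (A t0) ! m = \<mu>"
    and extr: "(\<forall>t. ordered_eigenvalues (A t) ! m \<le> \<mu>) \<or> (\<forall>t. \<mu> \<le> ordered_eigenvalues (A t) ! m)"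
  shows "((\<lambda>t. poly (char_poly (A t)) (of_real \<mu>)) has_derivative (\<lambda>h. 0)) (at t0)"
proof -
  define L where "L t = ordered_eigenvalues (A t)" for t
  have len: "length (L t) = n" for t using length_ordered_eigenvalues[OF A(1)] by (simp add: L_def)
  have fac: "poly (char_poly (A t)) z = (\<Prod>j<n. z - of_real (L t ! j))" for t z
    using poly_char_poly_hermitian[OF A] by (simp add: L_def)
  have Cc: "z \<cdot>\<^sub>m 1\<^sub>m n - A t \<in> carrier_mat n n" for z t using A(1) by (rule minus_carrier_mat)
  have Cdiff: "(\<lambda>t. (z \<cdot>\<^sub>m 1\<^sub>m n - A t) $$ (i, j)) differentiable (at t0)"
    if "i < n" "j < n" for z i j
  proof -
    have "(\<lambda>t. (z \<cdot>\<^sub>m 1\<^sub>m n - A t) $$ (i, j)) = (\<lambda>t. (if i = j then z else 0) - A t $$ (i, j))"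
      using that carrier_matD[OF A(1)] by (simp add: fun_eq_iff)
    then show ?thesis using diff[OF that] by simp
  qed
  have pdiff: "(\<lambda>t. poly (char_poly (A t)) z) differentiable (at t0)" for z
    unfolding poly_char_poly_det[OF A(1)] by (rule det_differentiable[OF Cc Cdiff])
  show ?thesis
  proof (cases "\<exists>j<n. j \<noteq> m \<and> L t0 ! j = \<mu>")
    case True
    then obtain j where j: "j < n" "j \<noteq> m" "L t0 ! j = \<mu>" by blast
    have "{j, m} \<subseteq> {i. i < length (L t0) \<and> L t0 ! i = \<mu>}"
      using j m \<mu> len by (auto simp: L_def)
    then have "card {j, m} \<le> card {i. i < length (L t0) \<and> L t0 ! i = \<mu>}"
      by (intro card_mono) auto
    also have "\<dots> = count (mset (L t0)) \<mu>"
      by (simp add: count_mset count_list_eq_length_filter length_filter_conv_card eq_commute[of \<mu>])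
    also have "\<dots> \<le> count (proots (char_poly (A t0))) (of_real \<mu>)"
      unfolding hermitian_proots[OF A] L_def by (rule count_le_count_image_mset)
    finally have "2 \<le> count (proots (char_poly (A t0))) (of_real \<mu>)" using j by simp
    then obtain P Q where PQ: "P \<in> carrier_mat n n" "Q \<in> carrier_mat n n" "Q * P = 1\<^sub>m n" "2 \<le> n"
      and zero: "\<And>i j. i < n \<Longrightarrow> j < 2 \<Longrightarrow> (Q * (of_real \<mu> \<cdot>\<^sub>m 1\<^sub>m n - A t0) * P) $$ (i, j) = 0"
      using hermitian_double_eigenvalue[OF A] by metis
    define C where "C t = of_real \<mu> \<cdot>\<^sub>m 1\<^sub>m n - A t" for t
    \<comment> \<open>P and Q are frozen at t0: the determinant is preserved for all t, while the
      two columns are required to vanish at t0 alone.\<close>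
    define M where "M t = Q * C t * P" for t
    have C: "C t \<in> carrier_mat n n" for t unfolding C_def by (rule Cc)
    have QC: "Q * C t \<in> carrier_mat n n" for t by (rule mult_carrier_mat[OF PQ(2) C])
    have Mc: "M t \<in> carrier_mat n n" for t
      unfolding M_def by (rule mult_carrier_mat[OF QC PQ(1)])
    have "det Q * det P = 1" using det_mult[OF PQ(2,1)] PQ(3) by simp
    moreover have "det (M t) = det Q * det (C t) * det P" for t
      unfolding M_def det_mult[OF QC PQ(1)] det_mult[OF PQ(2) C] ..
    ultimately have detM: "det (M t) = poly (char_poly (A t)) (of_real \<mu>)" for t
      unfolding poly_char_poly_det[OF A(1)] C_def[symmetric] by (metis mult.assoc mult.commute mult_1)
    have "((\<lambda>t. det (M t)) has_derivative (\<lambda>h. 0)) (at t0)"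
    proof (rule det_two_zero_columns_derivative[OF Mc PQ(4)])
      show "M t0 $$ (i, j) = 0" if "i < n" "j < 2" for i j 
        using zero[OF that] unfolding M_def C_def .
      fix i j assume ij: "i < n" "j < n"
      have "M t $$ (i, j) = (\<Sum>l<n. (\<Sum>k<n. Q $$ (i, k) * C t $$ (k, l)) * P $$ (l, j))" for t
        unfolding M_def mult_mat_entry[OF QC PQ(1) ij]
        using ij by (intro sum.cong refl) (simp add: mult_mat_entry[OF PQ(2) C])
      then have eq: "(\<lambda>t. M t $$ (i, j)) =
          (\<lambda>t. \<Sum>l<n. (\<Sum>k<n. Q $$ (i, k) * C t $$ (k, l)) * P $$ (l, j))"
        by blast
      show "(\<lambda>t. M t $$ (i, j)) differentiable (at t0)"
        unfolding eq C_def
        by (intro differentiable_sum differentiable_mult differentiable_const ballI Cdiff) (use ij in auto)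
    qed
    then show ?thesis by (simp add: detM)
  next
    case False
    define \<psi> where "\<psi> t = (\<Prod>j\<in>{..<n} - {m}. \<mu> - L t ! j)" for t
    define \<phi> where "\<phi> t = (\<mu> - L t ! m) * \<psi> t" for t
    have \<phi>: "poly (char_poly (A t)) (of_real \<mu>) = of_real (\<phi> t)" for t
      unfolding fac \<phi>_def \<psi>_def using m by (simp add: prod.remove[of "{..<n}" m])
    have "isCont (\<lambda>t. \<Prod>j<n. z - complex_of_real (L t ! j)) t0" for z
      using pdiff[of z] has_derivative_continuous unfolding differentiable_def fac by blast
    then have contL: "isCont (\<lambda>t. L t ! j) t0" if "j < n" for j
      using that len by (intro sorted_roots_continuous[of L n]) (simp_all add: L_def ordered_eigenvalues_def)
    have "isCont \<psi> t0"
      unfolding \<psi>_def using contL by (intro continuous_intros) auto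
    have \<psi>0: "\<psi> t0 \<noteq> 0" using False by (auto simp: \<psi>_def)
    \<comment> \<open>The factor \<open>\<psi> t0\<close> makes the cofactor positive near t0,
      whatever its sign, so one argument covers both.\<close>
    have "isCont (\<lambda>t. \<psi> t * \<psi> t0) t0"
      using \<open>isCont \<psi> t0\<close> by (intro continuous_intros)
    then have "((\<lambda>t. \<psi> t * \<psi> t0) \<longlongrightarrow> \<psi> t0 * \<psi> t0) (at t0)" by (simp add: isCont_def)
    moreover have "0 < \<psi> t0 * \<psi> t0" using \<psi>0 by (metis not_real_square_gt_zero)
    ultimately have "\<forall>\<^sub>F t in at t0. 0 < \<psi> t * \<psi> t0" by (rule order_tendstoD)
    then obtain d where d: "d > 0" "\<And>t. t \<noteq> t0 \<Longrightarrow> dist t t0 < d \<Longrightarrow> 0 < \<psi> t * \<psi> t0"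
      unfolding eventually_at by blast
    have pos: "0 \<le> \<psi> t * \<psi> t0" if "\<bar>t0 - t\<bar> < d" for t
      using d(2)[of t] that by (cases "t = t0") (auto simp: dist_real_def abs_minus_commute less_imp_le)
    have \<phi>0: "\<phi> t0 = 0" using \<mu> by (simp add: \<phi>_def L_def)
    have "(\<lambda>t. Re (poly (char_poly (A t)) (of_real \<mu>))) differentiable (at t0)"
      using pdiff[of "of_real \<mu>"] bounded_linear.has_derivative[OF bounded_linear_Re]
      unfolding differentiable_def by blast
    then have "\<phi> differentiable (at t0)" by (simp add: \<phi>)
    then obtain c where c: "(\<phi> has_real_derivative c) (at t0)" by (auto simp: real_differentiable_def)
    then have g: "((\<lambda>t. \<phi> t * \<psi> t0) has_real_derivative c * \<psi> t0) (at t0)"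
      by (rule DERIV_cmult_right)
    have g_eq: "\<phi> t * \<psi> t0 = (\<mu> - L t ! m) * (\<psi> t * \<psi> t0)" for t by (simp add: \<phi>_def)
    have "c * \<psi> t0 = 0"
      using extr
    proof
      assume le: "\<forall>t. ordered_eigenvalues (A t) ! m \<le> \<mu>"
      have "\<forall>t. \<bar>t0 - t\<bar> < d \<longrightarrow> \<phi> t0 * \<psi> t0 \<le> \<phi> t * \<psi> t0"
        unfolding \<phi>0 mult_zero_left g_eq L_def
        by (intro allI impI, rule mult_nonneg_nonneg) (use le pos in simp_all)
      then show ?thesis by (rule DERIV_local_min[OF g d(1)])
    next
      assume ge: "\<forall>t. \<mu> \<le> ordered_eigenvalues (A t) ! m"
      have "\<forall>t. \<bar>t0 - t\<bar> < d \<longrightarrow> \<phi> t * \<psi> t0 \<le> \<phi> t0 * \<psi> t0"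
        unfolding \<phi>0 mult_zero_left g_eq L_def
        by (intro allI impI, rule mult_nonpos_nonneg) (use ge pos in simp_all)
      then show ?thesis by (rule DERIV_local_max[OF g d(1)])
    qed
    then have "c = 0" using \<psi>0 by simp
    then have "(\<phi> has_derivative (\<lambda>h. 0)) (at t0)"
      using c by (simp add: has_field_derivative_def lambda_zero)
    then have "((\<lambda>t. complex_of_real (\<phi> t)) has_derivative (\<lambda>h. complex_of_real 0)) (at t0)"
      by (rule has_derivative_of_real)
    then show ?thesis by (simp add: \<phi>)
  qed
qed

section \<open>Extrema of the band functions\<close>

lemma floquet_matrix_carrier: "floquet_matrix q1 q2 V k \<in> carrier_mat (q1 * q2) (q1 * q2)"
  by (simp add: floquet_matrix_def)

lemma floquet_entry:
  fixes k :: "real \<times> real"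
  assumes "q1 > 0" "q2 > 0" "i < q1 * q2" "j < q1 * q2"
  shows "floquet_matrix q1 q2 V k $$ (i, j) =
    - (\<Sum>d\<in>hops. hop_weight q1 q2 V 0 i j d *
        exp (2 * of_real pi * \<i> * of_real (fst k)) powi wrap1 q1 i j d *
        exp (2 * of_real pi * \<i> * of_real (snd k)) powi wrap2 q1 q2 i j d)"
  using floquet_entry_hops[OF assms, of 0 V k] by (simp add: minus_equation_iff[of "floquet_matrix q1 q2 V k $$ (i, j)"])

lemma wraps_reverse: "wraps q1 q2 j i (- a, - b) \<longleftrightarrow> wraps q1 q2 i j (a, b)"
proof -
  have rev: "(u + - c - v) mod m = 0 \<longleftrightarrow> (v + c - u) mod m = 0" for u v c m :: int
    unfolding dvd_eq_mod_eq_0[symmetric] by (subst dvd_minus_iff[symmetric]) (simp add: algebra_simps)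
  show ?thesis unfolding wraps_def fst_conv snd_conv rev ..
qed

lemma wrap_reverse:
  assumes "q1 > 0" "q2 > 0" and w: "wraps q1 q2 i j (a, b)"
  shows "wrap1 q1 j i (- a, - b) = - wrap1 q1 i j (a, b)"
    and "wrap2 q1 q2 j i (- a, - b) = - wrap2 q1 q2 i j (a, b)"
proof -
  note w' = w[unfolded wraps_reverse[of q1 q2 j i a b, symmetric]]
  have "int q1 * wrap1 q1 j i (- a, - b) = int q1 * - wrap1 q1 i j (a, b)"
    using wraps_mult(1)[OF w] wraps_mult(1)[OF w'] by simp
  then show "wrap1 q1 j i (- a, - b) = - wrap1 q1 i j (a, b)"
    unfolding mult_cancel_left using assms(1) by simp
  have "int q2 * wrap2 q1 q2 j i (- a, - b) = int q2 * - wrap2 q1 q2 i j (a, b)"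
    using wraps_mult(2)[OF w] wraps_mult(2)[OF w'] by simp
  then show "wrap2 q1 q2 j i (- a, - b) = - wrap2 q1 q2 i j (a, b)"
    unfolding mult_cancel_left using assms(2) by simp
qed

lemma cnj_exp_2pi:
  "cnj (exp (2 * of_real pi * \<i> * of_real t)) = inverse (exp (2 * of_real pi * \<i> * of_real t))"
proof -
  have "exp (2 * of_real pi * \<i> * of_real t) = cis (2 * pi * t)"
    by (simp add: cis_conv_exp mult_ac)
  then show ?thesis by (simp add: cis_cnj cis_inverse)
qed

text \<open>Reversing a hop exchanges the two sites and negates both wrap numbers. As x and z lie on
  the unit circle, conjugation inverts them, so the hop sums of (i, j) and (j, i) are conjugate term
  by term.\<close>

lemma hermitian_floquet_matrix:
  assumes q: "q1 > 0" "q2 > 0"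
  shows "hermitian_mat (floquet_matrix q1 q2 V k)"
  unfolding hermitian_mat_def
proof (intro allI impI)
  fix i j assume "i < dim_row (floquet_matrix q1 q2 V k)" "j < dim_row (floquet_matrix q1 q2 V k)"
  then have i: "i < q1 * q2" and j: "j < q1 * q2" by (simp_all add: floquet_matrix_def)
  define x where "x = exp (2 * of_real pi * \<i> * of_real (fst k) :: complex)"
  define z where "z = exp (2 * of_real pi * \<i> * of_real (snd k) :: complex)"
  define f where "f i j d = hop_weight q1 q2 V 0 i j d * x powi wrap1 q1 i j d * z powi wrap2 q1 q2 i j d"
    for i j d
  have rev: "cnj (f j i (- a, - b)) = f i j (a, b)" for a b
  proof (cases "wraps q1 q2 i j (a, b)")
    case True
    have w: "hop_weight q1 q2 V 0 j i (- a, - b) = hop_weight q1 q2 V 0 i j (a, b)"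
    proof (cases "(a, b) = (0, 0)")
      case zero: True
      then have "j = i"
        using True wraps_iff_shift_index[OF q j] shift_index_zero[OF q(1) i] by simp
      then show ?thesis using zero by simp
    next
      case False
      then show ?thesis using True wraps_reverse[of q1 q2 j i a b] by (auto simp: hop_weight_def)
    qed
    have "cnj (hop_weight q1 q2 V 0 i j (a, b)) = hop_weight q1 q2 V 0 i j (a, b)"
      by (simp add: hop_weight_def)
    moreover have "cnj (x powi (- c)) = x powi c" "cnj (z powi (- c)) = z powi c" for c
      by (simp_all add: x_def z_def cnj_exp_2pi power_int_minus power_int_inverse)
    ultimately show ?thesis
      unfolding f_def w wrap_reverse[OF q True] complex_cnj_mult by simp
  next
    case False
    then show ?thesis using wraps_reverse[of q1 q2 j i a b] by (simp add: f_def hop_weight_def)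
  qed
  have "(\<Sum>d\<in>hops. cnj (f j i d)) = (\<Sum>d\<in>hops. f i j d)"
    using rev[of 0 0] rev[of 1 0] rev[of "- 1" 0] rev[of 0 1] rev[of 0 "- 1"]
    by (simp add: hops_def nbr_offsets_def)
  then show "floquet_matrix q1 q2 V k $$ (i, j) = cnj (floquet_matrix q1 q2 V k $$ (j, i))"
    unfolding floquet_entry[OF q i j] floquet_entry[OF q j i] f_def x_def z_def
    by (simp add: cnj_sum)
qed

section \<open>Periodicity and differentiability in \<open>k1\<close>\<close>

lemma exp_2pi_eq_iff:
  "exp (2 * of_real pi * \<i> * of_real s) = exp (2 * of_real pi * \<i> * of_real t) \<longleftrightarrow>
     (\<exists>n::int. s - t = of_int n)"
proof -
  have "exp (2 * of_real pi * \<i> * of_real s) = exp (2 * of_real pi * \<i> * of_real t) \<longleftrightarrow>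
      exp (2 * of_real pi * \<i> * of_real s - 2 * of_real pi * \<i> * of_real t) = 1"
    by (simp add: exp_diff)
  also have "2 * of_real pi * \<i> * of_real s - 2 * of_real pi * \<i> * of_real t =
      \<i> * complex_of_real (2 * pi * (s - t))"
    by (simp add: algebra_simps)
  also have "exp (\<i> * complex_of_real (2 * pi * (s - t))) = cis (2 * pi * (s - t))"
    by (simp add: cis_conv_exp)
  also have "cis (2 * pi * (s - t)) = 1 \<longleftrightarrow> cos (2 * pi * (s - t)) = 1"
    using cos_one_sin_zero[of "2 * pi * (s - t)"] by (auto simp: complex_eq_iff)
  also have "\<dots> \<longleftrightarrow> (\<exists>n::int. s - t = of_int n)"
  proof -
    have "2 * pi * (s - t) = of_int n * 2 * pi \<longleftrightarrow> s - t = of_int n" for n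
      by (simp add: mult.assoc[symmetric])
    then show ?thesis unfolding cos_one_2pi_int by simp
  qed
  finally show ?thesis .
qed

text \<open>This extends an extremum over the half-open cell to the whole line in the direction of
  \<open>k1\<close>, so that points with \<open>k1 = 0\<close> become interior points as
  well.\<close>

lemma floquet_matrix_frac:
  assumes q: "q1 > 0" "q2 > 0"
  shows "floquet_matrix q1 q2 V (frac t, k2) = floquet_matrix q1 q2 V (t, k2)"
proof (rule eq_matI)
  have "frac t - t = of_int (- \<lfloor>t\<rfloor>)" by (simp add: frac_def)
  then have x: "exp (2 * of_real pi * \<i> * of_real (frac t)) = exp (2 * complex_of_real pi * \<i> * of_real t)"
    unfolding exp_2pi_eq_iff by blast
  fix i j
  assume "i < dim_row (floquet_matrix q1 q2 V (t, k2))" "j < dim_col (floquet_matrix q1 q2 V (t, k2))"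
  then have i: "i < q1 * q2" and j: "j < q1 * q2" by (simp_all add: floquet_matrix_def)
  show "floquet_matrix q1 q2 V (frac t, k2) $$ (i, j) = floquet_matrix q1 q2 V (t, k2) $$ (i, j)"
    unfolding floquet_entry[OF q i j] fst_conv snd_conv x ..
qed (simp_all add: floquet_matrix_def)

lemma exp_line_has_derivative:
  fixes c :: complex
  shows "((\<lambda>t. exp (c * of_real t)) has_derivative (\<lambda>h. exp (c * of_real t0) * (c * of_real h))) (at t0)"
proof -
  have "((\<lambda>t. c * of_real t) has_derivative (\<lambda>h. c * of_real h)) (at t0)"
    by (intro derivative_intros)
  moreover have "(exp has_derivative (*) (exp (c * of_real t0))) (at (c * of_real t0))"
    using DERIV_exp[of "c * of_real t0"] by (simp add: has_field_derivative_def)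
  ultimately show ?thesis by (rule has_derivative_compose)
qed

lemma floquet_entry_differentiable:
  assumes "q1 > 0" "q2 > 0" "i < q1 * q2" "j < q1 * q2"
  shows "(\<lambda>t. floquet_matrix q1 q2 V (t, k2) $$ (i, j)) differentiable (at t0)"
proof -
  have "(\<lambda>t. exp (2 * complex_of_real pi * \<i> * of_real t)) differentiable (at t0)"
    using exp_line_has_derivative unfolding differentiable_def by blast
  then show ?thesis
    unfolding floquet_entry[OF assms] fst_conv snd_conv
    by (intro differentiable_minus differentiable_sum differentiable_mult differentiable_const
        differentiable_power_int ballI) (simp_all add: hops_def)
qed

text \<open>Differentiation in \<open>k1\<close> is 2 pi i times x d/dx. It multiplies the
  coefficients by a, so no exponent outside the diamond appears.\<close>

lemma laurent2_has_derivative: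
  "((\<lambda>t. laurent2 q1 q2 p (exp (2 * of_real pi * \<i> * of_real t)) z) has_derivative
     (\<lambda>h. 2 * of_real pi * \<i> * of_real h *
        laurent2 q1 q2 (\<lambda>a b. of_int a * p a b) (exp (2 * of_real pi * \<i> * of_real t0)) z)) (at t0)"
proof -
  define c where "c = 2 * complex_of_real pi * \<i>"
  have pw: "exp (c * of_real t) powi a = exp ((of_int a * c) * of_real t)" for a t
    by (simp add: exp_power_int mult.assoc)
  have "((\<lambda>t. p a b * exp ((of_int a * c) * of_real t) * z powi b) has_derivative
      (\<lambda>h. p a b * (exp ((of_int a * c) * of_real t0) * ((of_int a * c) * of_real h)) * z powi b)) (at t0)" for a b
    by (intro has_derivative_mult_left has_derivative_mult_right exp_line_has_derivative)
  then have "((\<lambda>t. laurent2 q1 q2 p (exp (c * of_real t)) z) has_derivative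
      (\<lambda>h. \<Sum>(a, b)\<in>{- int q2..int q2} \<times> {- int q1..int q1}.
        p a b * (exp ((of_int a * c) * of_real t0) * ((of_int a * c) * of_real h)) * z powi b)) (at t0)"
    unfolding laurent2_def pw case_prod_beta by (intro has_derivative_sum)
  also have "(\<lambda>h. \<Sum>(a, b)\<in>{- int q2..int q2} \<times> {- int q1..int q1}.
        p a b * (exp ((of_int a * c) * of_real t0) * ((of_int a * c) * of_real h)) * z powi b) =
      (\<lambda>h. c * of_real h * laurent2 q1 q2 (\<lambda>a b. of_int a * p a b) (exp (c * of_real t0)) z)"
    unfolding laurent2_def pw sum_distrib_left case_prod_beta
    by (intro ext sum.cong refl) (simp add: mult_ac)
  finally show ?thesis by (simp only: c_def)
qed

theorem theorem4p1:
  fixes q1 q2 m :: nat and V :: "int \<times> int \<Rightarrow> real" and lam :: real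
  assumes "q1 > 0" and "q2 > 0" and "coprime q1 q2"
    and "periodic2 q1 q2 V"
    and "1 \<le> m" and "m \<le> q1 * q2"
    and "\<exists>k0\<in>unit_cell. band q1 q2 V m k0 = lam"
    and "(\<forall>k\<in>unit_cell. band q1 q2 V m k \<le> lam) \<or> (\<forall>k\<in>unit_cell. lam \<le> band q1 q2 V m k)"
  shows "finite {k \<in> unit_cell. band q1 q2 V m k = lam}
       \<and> card {k \<in> unit_cell. band q1 q2 V m k = lam} \<le> 4 * q1 * q2"
proof -
  note q = assms(1,2)
  define S where "S = {k \<in> unit_cell. band q1 q2 V m k = lam}"
  define e where "e t = exp (2 * of_real pi * \<i> * of_real t :: complex)" for t :: real
  obtain p where p: "newton_diamond q1 q2 p"
    and char: "\<And>k. poly (char_poly (floquet_matrix q1 q2 V k)) (of_real lam) =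
      laurent2 q1 q2 p (e (fst k)) (e (snd k))"
    using det_floquet_laurent[OF q assms(3), of V "of_real lam"] unfolding e_def by blast
  define Z where "Z = {(x, z). x \<noteq> 0 \<and> z \<noteq> 0 \<and> laurent2 q1 q2 p x z = 0 \<and>
    laurent2 q1 q2 (\<lambda>a b. of_int a * p a b) x z = 0}"
  have Z: "finite Z" "card Z \<le> 4 * q1 * q2"
    using newton_diamond.card_torus_singular_points[OF p] by (simp_all add: Z_def)
  have band: "band q1 q2 V m k = ordered_eigenvalues (floquet_matrix q1 q2 V k) ! (m - 1)" for k
    by (simp add: band_def ordered_eigenvalues_def)
  have m: "m - 1 < q1 * q2" using assms(5,6) by linarith
  have "(e (fst k), e (snd k)) \<in> Z" if "k \<in> S" for k
  proof -
    obtain k1 k2 where k: "k = (k1, k2)" by force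
    have cell: "(k1, k2) \<in> unit_cell" and lam: "band q1 q2 V m (k1, k2) = lam"
      using that by (auto simp: S_def k)
    have "band q1 q2 V m (t, k2) = band q1 q2 V m (frac t, k2)" for t
      by (simp add: band floquet_matrix_frac[OF q])
    moreover have "(frac t, k2) \<in> unit_cell" for t
      using cell frac_lt_1 by (simp add: unit_cell_def)
    ultimately have extr: "(\<forall>t. band q1 q2 V m (t, k2) \<le> lam) \<or> (\<forall>t. lam \<le> band q1 q2 V m (t, k2))"
      using assms(8) by metis
    have "((\<lambda>t. poly (char_poly (floquet_matrix q1 q2 V (t, k2))) (of_real lam)) has_derivative
        (\<lambda>h. 0)) (at k1)"
      using extr lam unfolding band
      by (intro eigenvalue_extremum_critical[OF floquet_matrix_carrier hermitian_floquet_matrix[OF q]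
            floquet_entry_differentiable[OF q] m])
    then have "((\<lambda>t. laurent2 q1 q2 p (e t) (e k2)) has_derivative (\<lambda>h. 0)) (at k1)"
      by (simp add: char)
    \<comment> \<open>The two derivatives agree as linear maps; they are compared at h = 1, and the
      factor 2 pi i is nonzero.\<close>
    from has_derivative_unique[OF this laurent2_has_derivative[of q1 q2 p "e k2" k1, folded e_def]]
    have "2 * of_real pi * \<i> * of_real 1 * laurent2 q1 q2 (\<lambda>a b. of_int a * p a b) (e k1) (e k2) = 0"
      by metis
    then have "laurent2 q1 q2 (\<lambda>a b. of_int a * p a b) (e k1) (e k2) = 0" by simp
    moreover have "laurent2 q1 q2 p (e k1) (e k2) = 0"
    proof -
      have "poly (char_poly (floquet_matrix q1 q2 V (k1, k2))) (of_real lam) = 0"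
        unfolding poly_char_poly_hermitian[OF floquet_matrix_carrier hermitian_floquet_matrix[OF q]]
        using lam m by (intro prod_zero bexI[of _ "m - 1"]) (auto simp: band)
      then show ?thesis by (simp add: char)
    qed
    ultimately show ?thesis by (simp add: Z_def k e_def)
  qed
  then have sub: "(\<lambda>k. (e (fst k), e (snd k))) ` S \<subseteq> Z" by blast
  \<comment> \<open>The cell being half-open, coordinates with equal multipliers differ by an
    integer of absolute value below 1. So distinct k give distinct points of Z.\<close>
  have e_inj: "s = t" if eq: "e s = e t" and "0 \<le> s" "s < 1" "0 \<le> t" "t < 1" for s t
  proof -
    obtain n :: int where n: "s - t = of_int n" using eq unfolding e_def exp_2pi_eq_iff by blast
    then have "- 1 < real_of_int n" "real_of_int n < 1" using that by linarith+
    then have "n = 0" by linarith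
    then show ?thesis using n by simp
  qed
  have "inj_on (\<lambda>k. (e (fst k), e (snd k))) S"
    by (rule inj_onI) (auto simp: S_def unit_cell_def prod_eq_iff intro: e_inj)
  then have "finite S \<and> card S \<le> card Z"
    using sub Z(1) by (meson card_inj_on_le inj_on_finite)
  then show ?thesis using Z(2) by (simp add: S_def)
qed

end
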